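(* Let $A=\mathcal{O}_\theta(\mathbb{T}^2)$ be the noncommutative algebraic $2$-torus ($\theta\in\mathbb{R}$), viewed as a right comodule algebra over $H=\mathcal{O}(U(1))=\mathbb{C}[t,t^{-1}]$, with the differential calculi $\Omega^\bullet(A)=A\oplus\Omega^1(A)\oplus\Omega^2(A)$ and $\Omega^\bullet(H)=H\oplus\Omega^1(H)$ described in the context. Then $\Omega^\bullet(A)$ is complete. Moreover, with $B=A^{\mathrm{co}H}$: (i) the base forms are $\Omega^\bullet(B)=B\oplus\Omega^1(B)$ and are generated by $B$, i.e. $\Omega^\bullet(B)\subseteq\Omega^\bullet(A)$ is the pullback differential calculus on $B$ (in particular $\Omega^1(B)=B\,\mathrm{d}B$); (ii) $\mathrm{ver}^\bullet=A\otimes(\mathbb{C}\oplus\Lambda^1)$ with $\Lambda^1=\mathrm{span}_{\mathbb{C}}\{t^{-1}\mathrm{d}t\}$, and $\mathrm{hor}^\bullet=A\,\Omega^\bullet(B)A$; (iii) the linear map $\Lambda^1\to\Omega^1(A)$, $t^{-1}\mathrm{d}t\mapsto u^{-1}\mathrm{d}u$, is a connection $1$-form on $\Omega^1(A)$.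
   Context: Algebras: $A=\mathcal{O}_\theta(\mathbb{T}^2)=\mathbb{C}[u,u^{-1},v,v^{-1}]/\langle vu-e^{\mathrm{i}\theta}uv\rangle$ (two invertible generators with $vu=e^{\mathrm{i}\theta}uv$). $H=\mathbb{C}[t,t^{-1}]$ with $\Delta(t)=t\otimes t$, $\varepsilon(t)=1$, $S(t)=t^{-1}$. The coaction $\Delta_A\colon A\to A\otimes H$ is the algebra map with $u\mapsto u\otimes t$, $v\mapsto v\otimes t^{-1}$. Then $B=A^{\mathrm{co}H}=\mathrm{span}_{\mathbb{C}}\{(uv)^k:k\in\mathbb{Z}\}$. Calculi: a differential calculus (DC) on an algebra $A$ is a differential graded algebra (DGA) $(\Omega^\bullet,\wedge,\mathrm{d})$ with $\Omega^0=A$ and $\Omega^k=\mathrm{span}\{a^0\mathrm{d}a^1\wedge\ldots\wedge\mathrm{d}a^k\}$. On $H$: $\Omega^1(H)$ is the free left $H$-module on $\mathrm{d}t$ with $\mathrm{d}t\,t=t\,\mathrm{d}t$, and $\Omega^k(H)=0$ for $k\ge2$ (the classical calculus). On $A$: $\Omega^1(A)$ is the free left $A$-module with basis $\mathrm{d}u,\mathrm{d}v$ and relations $\mathrm{d}u\,u=u\,\mathrm{d}u$, $\mathrm{d}v\,v=v\,\mathrm{d}v$, $\mathrm{d}u\,v=e^{-\mathrm{i}\theta}v\,\mathrm{d}u$, $\mathrm{d}v\,u=e^{\mathrm{i}\theta}u\,\mathrm{d}v$; $\Omega^2(A)$ is the free left $A$-module on $\mathrm{d}u\wedge\mathrm{d}v$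 with $\mathrm{d}u\wedge\mathrm{d}v+e^{-\mathrm{i}\theta}\mathrm{d}v\wedge\mathrm{d}u=0$, $\mathrm{d}u\wedge\mathrm{d}u=0=\mathrm{d}v\wedge\mathrm{d}v$; $\Omega^k(A)=0$ for $k>2$. Complete: $\Delta_A$ extends to a morphism of DGAs $\Delta_A^\bullet\colon\Omega^\bullet(A)\to\Omega^\bullet(A)\otimes\Omega^\bullet(H)$, where the tensor product DGA has product $(\omega\otimes\omega')\wedge(\eta\otimes\eta')=(-1)^{|\omega'||\eta|}\omega\wedge\eta\otimes\omega'\wedge\eta'$ and differential $\mathrm{d}_\otimes(\omega\otimes\omega')=\mathrm{d}\omega\otimes\omega'+(-1)^{|\omega|}\omega\otimes\mathrm{d}\omega'$. Base forms: $\Omega^\bullet(B)=\{\omega\in\Omega^\bullet(A):\Delta_A^\bullet(\omega)=\omega\otimes1\}$. Horizontal forms: $\mathrm{hor}^\bullet=(\Delta_A^\bullet)^{-1}(\Omega^\bullet(A)\otimes H)$. Vertical forms: $\mathrm{ver}^\bullet=A\otimes\Lambda^\bullet$, where $\Lambda^\bullet$ is the space of left $H$-coinvariant forms in $\Omega^\bullet(H)$ (left coaction $h\,\mathrm{d}g\mapsto h_1g_1\otimes h_2\mathrm{d}g_2$). The pullback calculus on $B$ is the differential graded subalgebra of $\Omega^\bullet(A)$ spanned by $b^0\mathrm{d}b^1\wedge\ldots\wedge\mathrm{d}b^k$, $b^i\in B$. Connection $1$-form: a right $H$-colinear map $s\colon\Lambda^1\to\Omega^1(A)$ with $\pi_v(s(\vartheta))=1\otimes\vartheta$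 for all $\vartheta\in\Lambda^1$, where $\Lambda^1$ carries the adjoint coaction $S(h_1)\mathrm{d}h_2\mapsto S(h_2)\mathrm{d}h_3\otimes S(h_1)h_4$, $\Omega^1(A)$ carries $a\,\mathrm{d}a'\mapsto a_0\mathrm{d}a'_0\otimes a_1a'_1$, and $\pi_v\colon\Omega^1(A)\to A\otimes\Lambda^1$, $\pi_v(a\,\mathrm{d}a')=aa'_0\otimes S(a'_1)\mathrm{d}a'_2$. *)

theory Defs
  imports Complex_Main "HOL-Library.Poly_Mapping"
begin

section \<open>Complex vector spaces with a basis\<close>

text \<open>
  Every complex vector space has a basis, so vector spaces are represented as spaces of finitely
  supported coefficient functions on an index type. The tensor product of the spaces over \<^term>\<open>I\<close>
  and \<^term>\<open>J\<close> is then the space over \<^term>\<open>I \<times> J\<close>.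
\<close>

type_synonym 'i fvec = "'i \<Rightarrow>\<^sub>0 complex"

definition scl :: "complex \<Rightarrow> 'i fvec \<Rightarrow> 'i fvec"
  where "scl c = Poly_Mapping.map ((*) c)"

abbreviation bas :: "'i \<Rightarrow> 'i fvec"
  where "bas i \<equiv> Poly_Mapping.single i 1"

lemma lookup_scl [simp]: "Poly_Mapping.lookup (scl c x) i = c * Poly_Mapping.lookup x i"
  unfolding scl_def by transfer (simp add: when_def)

interpretation fvec: vector_space "scl :: complex \<Rightarrow> 'i fvec \<Rightarrow> 'i fvec"
  by unfold_locales (auto intro!: poly_mapping_eqI simp: lookup_add algebra_simps)

abbreviation lin :: "('i fvec \<Rightarrow> 'j fvec) \<Rightarrow> bool"
  where "lin \<equiv> Vector_Spaces.linear scl scl"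

definition linext :: "('i \<Rightarrow> 'j fvec) \<Rightarrow> 'i fvec \<Rightarrow> 'j fvec"
  where "linext f x = (\<Sum>i\<in>Poly_Mapping.keys x. scl (Poly_Mapping.lookup x i) (f i))"

definition bilext :: "('i \<Rightarrow> 'j \<Rightarrow> 'k fvec) \<Rightarrow> 'i fvec \<Rightarrow> 'j fvec \<Rightarrow> 'k fvec"
  where "bilext f x y = linext (\<lambda>i. linext (f i) y) x"

definition tens :: "'i fvec \<Rightarrow> 'j fvec \<Rightarrow> ('i \<times> 'j) fvec"
  where "tens = bilext (\<lambda>i j. bas (i, j))"

definition tmap :: "('i fvec \<Rightarrow> 'k fvec) \<Rightarrow> ('j fvec \<Rightarrow> 'l fvec) \<Rightarrow> ('i \<times> 'j) fvec \<Rightarrow> ('k \<times> 'l) fvec"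
  where "tmap f g = linext (\<lambda>(i, j). tens (f (bas i)) (g (bas j)))"

definition sub_tens :: "'i fvec set \<Rightarrow> 'j fvec set \<Rightarrow> ('i \<times> 'j) fvec set"
  where "sub_tens U V = fvec.span {tens x y |x y. x \<in> U \<and> y \<in> V}"

definition is_dsum :: "'i fvec set \<Rightarrow> 'i fvec set \<Rightarrow> 'i fvec set \<Rightarrow> bool"
  where "is_dsum W U V \<longleftrightarrow> W = {x + y |x y. x \<in> U \<and> y \<in> V} \<and> U \<inter> V = {0}"

definition lin_on :: "'i fvec set \<Rightarrow> ('i fvec \<Rightarrow> 'j fvec) \<Rightarrow> bool"
  where "lin_on W f \<longleftrightarrow> fvec.subspace W \<and> (\<forall>x\<in>W. \<forall>y\<in>W. f (x + y) = f x + f y)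
    \<and> (\<forall>c. \<forall>x\<in>W. f (scl c x) = scl c (f x))"

text \<open>
  \<open>the_lin W P\<close> is the linear map on the subspace \<^term>\<open>W\<close> determined by the prescription \<^term>\<open>P\<close>.
  It is extended by 0 outside \<^term>\<open>W\<close> (which is not linear there) only to pin down a HOL function.
\<close>

definition the_lin :: "'i fvec set \<Rightarrow> (('i fvec \<Rightarrow> 'j fvec) \<Rightarrow> bool) \<Rightarrow> 'i fvec \<Rightarrow> 'j fvec"
  where "the_lin W P = (THE f. lin_on W f \<and> (\<forall>x. x \<notin> W \<longrightarrow> f x = 0) \<and> P f)"

text \<open>
  \<open>tmap_on s\<close> is the map \<open>s \<otimes> id\<close> on \<open>W \<otimes> V\<close> for a map \<^term>\<open>s\<close> that is meaningful on the subspace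
  \<^term>\<open>W\<close> only: the argument is written as a sum of \<open>slice l z \<otimes> bas l\<close>, where all slices are in \<^term>\<open>W\<close>.
\<close>

definition slice :: "'l \<Rightarrow> ('i \<times> 'l) fvec \<Rightarrow> 'i fvec"
  where "slice l = linext (\<lambda>(i, k). if k = l then bas i else 0)"

definition tmap_on :: "('i fvec \<Rightarrow> 'k fvec) \<Rightarrow> ('i \<times> 'l) fvec \<Rightarrow> ('k \<times> 'l) fvec"
  where "tmap_on s z = (\<Sum>l\<in>snd ` Poly_Mapping.keys z. tens (s (slice l z)) (bas l))"


section \<open>Algebras, Hopf algebras and differential graded algebras\<close>

record 'i alg =
  mul :: "'i fvec \<Rightarrow> 'i fvec \<Rightarrow> 'i fvec"
  unt :: "'i fvec"

record 'i hopf = "'i alg" +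
  comul :: "'i fvec \<Rightarrow> ('i \<times> 'i) fvec"
  counit :: "'i fvec \<Rightarrow> complex"
  antipode :: "'i fvec \<Rightarrow> 'i fvec"

text \<open>A grading is given by the degrees of the basis vectors.\<close>

record 'i dga = "'i alg" +
  deg :: "'i \<Rightarrow> nat"
  dif :: "'i fvec \<Rightarrow> 'i fvec"

definition bilin :: "('i fvec \<Rightarrow> 'j fvec \<Rightarrow> 'k fvec) \<Rightarrow> bool"
  where "bilin f \<longleftrightarrow> (\<forall>x. lin (f x)) \<and> (\<forall>y. lin (\<lambda>x. f x y))"

definition is_alg :: "('i, 'r) alg_scheme \<Rightarrow> bool"
  where "is_alg R \<longleftrightarrow> bilin (mul R) \<and> (\<forall>x y z. mul R (mul R x y) z = mul R x (mul R y z))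
    \<and> (\<forall>x. mul R (unt R) x = x \<and> mul R x (unt R) = x)"

definition alg_hom :: "('i, 'r) alg_scheme \<Rightarrow> ('j, 's) alg_scheme \<Rightarrow> ('i fvec \<Rightarrow> 'j fvec) \<Rightarrow> bool"
  where "alg_hom R S f \<longleftrightarrow> lin f \<and> (\<forall>x y. f (mul R x y) = mul S (f x) (f y)) \<and> f (unt R) = unt S"

definition alg_tens :: "('i, 'r) alg_scheme \<Rightarrow> ('j, 's) alg_scheme \<Rightarrow> ('i \<times> 'j) alg"
  where "alg_tens R S = \<lparr>
    mul = bilext (\<lambda>(i, j) (k, l). tens (mul R (bas i) (bas k)) (mul S (bas j) (bas l))),
    unt = tens (unt R) (unt S)\<rparr>"

definition is_hopf :: "'i hopf \<Rightarrow> bool"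
  where "is_hopf H \<longleftrightarrow> is_alg H \<and> alg_hom H (alg_tens H H) (comul H)
    \<and> (\<forall>h. tmap id (comul H) (comul H h)
          = linext (\<lambda>((i, j), k). bas (i, (j, k))) (tmap (comul H) id (comul H h)))
    \<and> (\<forall>c x. counit H (scl c x) = c * counit H x)
    \<and> (\<forall>x y. counit H (x + y) = counit H x + counit H y)
    \<and> (\<forall>x y. counit H (mul H x y) = counit H x * counit H y) \<and> counit H (unt H) = 1
    \<and> (\<forall>h. linext (\<lambda>(i, j). scl (counit H (bas i)) (bas j)) (comul H h) = h)
    \<and> (\<forall>h. linext (\<lambda>(i, j). scl (counit H (bas j)) (bas i)) (comul H h) = h)
    \<and> lin (antipode H)
    \<and> (\<forall>h. linext (\<lambda>(i, j). mul H (antipode H (bas i)) (bas j)) (comul H h) = scl (counit H h) (unt H))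
    \<and> (\<forall>h. linext (\<lambda>(i, j). mul H (bas i) (antipode H (bas j))) (comul H h) = scl (counit H h) (unt H))"

definition hcomp :: "('i, 'r) dga_scheme \<Rightarrow> nat \<Rightarrow> 'i fvec set"
  where "hcomp \<Omega> k = {x. \<forall>i\<in>Poly_Mapping.keys x. deg \<Omega> i = k}"

definition is_dga :: "'i dga \<Rightarrow> bool"
  where "is_dga \<Omega> \<longleftrightarrow> is_alg \<Omega> \<and> unt \<Omega> \<in> hcomp \<Omega> 0
    \<and> (\<forall>k l. \<forall>x\<in>hcomp \<Omega> k. \<forall>y\<in>hcomp \<Omega> l. mul \<Omega> x y \<in> hcomp \<Omega> (k + l))
    \<and> lin (dif \<Omega>) \<and> (\<forall>k. \<forall>x\<in>hcomp \<Omega> k. dif \<Omega> x \<in> hcomp \<Omega> (Suc k)) \<and> (\<forall>x. dif \<Omega> (dif \<Omega> x) = 0)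
    \<and> (\<forall>k. \<forall>x\<in>hcomp \<Omega> k. \<forall>y.
          dif \<Omega> (mul \<Omega> x y) = mul \<Omega> (dif \<Omega> x) y + scl ((-1) ^ k) (mul \<Omega> x (dif \<Omega> y)))"

definition dga_hom :: "'i dga \<Rightarrow> 'j dga \<Rightarrow> ('i fvec \<Rightarrow> 'j fvec) \<Rightarrow> bool"
  where "dga_hom \<Omega> \<Omega>' f \<longleftrightarrow> alg_hom \<Omega> \<Omega>' f \<and> (\<forall>k. \<forall>x\<in>hcomp \<Omega> k. f x \<in> hcomp \<Omega>' k)
    \<and> (\<forall>x. f (dif \<Omega> x) = dif \<Omega>' (f x))"

definition dga_tens :: "'i dga \<Rightarrow> 'j dga \<Rightarrow> ('i \<times> 'j) dga"
  where "dga_tens \<Omega> \<Omega>' = \<lparr>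
    mul = bilext (\<lambda>(i, j) (k, l).
      scl ((-1) ^ (deg \<Omega>' j * deg \<Omega> k)) (tens (mul \<Omega> (bas i) (bas k)) (mul \<Omega>' (bas j) (bas l)))),
    unt = tens (unt \<Omega>) (unt \<Omega>'),
    deg = (\<lambda>(i, j). deg \<Omega> i + deg \<Omega>' j),
    dif = linext (\<lambda>(i, j). tens (dif \<Omega> (bas i)) (bas j)
      + scl ((-1) ^ deg \<Omega> i) (tens (bas i) (dif \<Omega>' (bas j))))\<rparr>"

text \<open>
  The form \<open>a db\<^sub>1 \<and> \<dots> \<and> db\<^sub>k\<close>, where \<^term>\<open>e\<close> is the identification of the algebra with the
  degree 0 part of the calculus.
\<close>

definition form :: "('i, 'r) dga_scheme \<Rightarrow> ('a fvec \<Rightarrow> 'i fvec) \<Rightarrow> 'a fvec \<Rightarrow> 'a fvec list \<Rightarrow> 'i fvec"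
  where "form \<Omega> e a bs = foldl (\<lambda>\<omega> b. mul \<Omega> \<omega> (dif \<Omega> (e b))) (e a) bs"

definition is_calculus :: "('a, 'r) alg_scheme \<Rightarrow> 'i dga \<Rightarrow> ('a fvec \<Rightarrow> 'i fvec) \<Rightarrow> bool"
  where "is_calculus A \<Omega> e \<longleftrightarrow> is_dga \<Omega> \<and> alg_hom A \<Omega> e \<and> bij_betw e UNIV (hcomp \<Omega> 0)
    \<and> (\<forall>k. hcomp \<Omega> k = fvec.span {form \<Omega> e a bs |a bs. length bs = k})"


section \<open>Calculi on comodule algebras\<close>

text \<open>
  A comodule algebra \<open>\<Delta>\<^sub>A : A \<rightarrow> A \<otimes> H\<close> with calculi on \<open>A\<close> and \<open>H\<close>, together with the identifications
  of \<open>A\<close> and \<open>H\<close> with the degree 0 parts of the calculi.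
\<close>

record ('a, 'o, 'h, 'w) cdata =
  calg :: "'a alg"
  chopf :: "'h hopf"
  coact :: "'a fvec \<Rightarrow> ('a \<times> 'h) fvec"
  frm :: "'o dga"
  emb :: "'a fvec \<Rightarrow> 'o fvec"
  hfrm :: "'w dga"
  hemb :: "'h fvec \<Rightarrow> 'w fvec"

definition is_cdata :: "('a, 'o, 'h, 'w) cdata \<Rightarrow> bool"
  where "is_cdata X \<longleftrightarrow> is_alg (calg X) \<and> is_hopf (chopf X)
    \<and> alg_hom (calg X) (alg_tens (calg X) (chopf X)) (coact X)
    \<and> (\<forall>a. tmap id (comul (chopf X)) (coact X a)
          = linext (\<lambda>((i, j), k). bas (i, (j, k))) (tmap (coact X) id (coact X a)))
    \<and> (\<forall>a. linext (\<lambda>(i, j). scl (counit (chopf X) (bas j)) (bas i)) (coact X a) = a)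
    \<and> is_calculus (calg X) (frm X) (emb X) \<and> is_calculus (chopf X) (hfrm X) (hemb X)"

definition coinv :: "('a, 'o, 'h, 'w) cdata \<Rightarrow> 'a fvec set"
  where "coinv X = {a. coact X a = tens a (unt (chopf X))}"

definition extends_coact :: "('a, 'o, 'h, 'w) cdata \<Rightarrow> ('o fvec \<Rightarrow> ('o \<times> 'w) fvec) \<Rightarrow> bool"
  where "extends_coact X F \<longleftrightarrow> dga_hom (frm X) (dga_tens (frm X) (hfrm X)) F
    \<and> (\<forall>a. F (emb X a) = tmap (emb X) (hemb X) (coact X a))"

definition complete_calculus :: "('a, 'o, 'h, 'w) cdata \<Rightarrow> bool"
  where "complete_calculus X \<longleftrightarrow> (\<exists>F. extends_coact X F)"

definition ext_coact :: "('a, 'o, 'h, 'w) cdata \<Rightarrow> 'o fvec \<Rightarrow> ('o \<times> 'w) fvec"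
  where "ext_coact X = (THE F. extends_coact X F)"

definition base_forms :: "('a, 'o, 'h, 'w) cdata \<Rightarrow> 'o fvec set"
  where "base_forms X = {\<omega>. ext_coact X \<omega> = tens \<omega> (unt (hfrm X))}"

definition base_forms1 :: "('a, 'o, 'h, 'w) cdata \<Rightarrow> 'o fvec set"
  where "base_forms1 X = base_forms X \<inter> hcomp (frm X) 1"

definition hor_forms :: "('a, 'o, 'h, 'w) cdata \<Rightarrow> 'o fvec set"
  where "hor_forms X = {\<omega>. ext_coact X \<omega> \<in> sub_tens UNIV (range (hemb X))}"

definition pullback_calculus :: "('a, 'o, 'h, 'w) cdata \<Rightarrow> 'a fvec set \<Rightarrow> 'o fvec set"
  where "pullback_calculus X B =
    fvec.span {form (frm X) (emb X) b bs |b bs. b \<in> B \<and> set bs \<subseteq> B}"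

text \<open>
  The left coaction on forms over \<open>H\<close> is \<open>h dg \<mapsto> h\<^sub>1 g\<^sub>1 \<otimes> h\<^sub>2 dg\<^sub>2\<close>, and the
  analogous formula in every degree.
\<close>

definition left_coact :: "('a, 'o, 'h, 'w) cdata \<Rightarrow> 'w fvec \<Rightarrow> ('h \<times> 'w) fvec"
  where "left_coact X = the_lin UNIV (\<lambda>L.
    (\<forall>h. L (hemb X h) = tmap id (hemb X) (comul (chopf X) h)) \<and>
    (\<forall>\<omega> g. L (mul (hfrm X) \<omega> (dif (hfrm X) (hemb X g)))
        = mul (alg_tens (chopf X) (hfrm X)) (L \<omega>)
            (tmap id (dif (hfrm X) \<circ> hemb X) (comul (chopf X) g))))"

definition coinv_forms :: "('a, 'o, 'h, 'w) cdata \<Rightarrow> 'w fvec set"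
  where "coinv_forms X = {\<eta>. left_coact X \<eta> = tens (unt (chopf X)) \<eta>}"

definition coinv_forms1 :: "('a, 'o, 'h, 'w) cdata \<Rightarrow> 'w fvec set"
  where "coinv_forms1 X = coinv_forms X \<inter> hcomp (hfrm X) 1"

definition ver_forms :: "('a, 'o, 'h, 'w) cdata \<Rightarrow> ('a \<times> 'w) fvec set"
  where "ver_forms X = sub_tens UNIV (coinv_forms X)"

text \<open>The form \<open>S(g) dh\<close>; the next map is \<open>h \<mapsto> S(h\<^sub>1) dh\<^sub>2\<close>.\<close>

definition sdif :: "('a, 'o, 'h, 'w) cdata \<Rightarrow> 'h fvec \<Rightarrow> 'h fvec \<Rightarrow> 'w fvec"
  where "sdif X g h = mul (hfrm X) (hemb X (antipode (chopf X) g)) (dif (hfrm X) (hemb X h))"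

definition mc_form :: "('a, 'o, 'h, 'w) cdata \<Rightarrow> 'h fvec \<Rightarrow> 'w fvec"
  where "mc_form X h = linext (\<lambda>(i, j). sdif X (bas i) (bas j)) (comul (chopf X) h)"

definition comul4 :: "'h hopf \<Rightarrow> 'h fvec \<Rightarrow> ('h \<times> 'h \<times> 'h \<times> 'h) fvec"
  where "comul4 H h = tmap id (tmap id (comul H)) (tmap id (comul H) (comul H h))"

text \<open>\<open>S(h\<^sub>1) dh\<^sub>2 \<mapsto> S(h\<^sub>2) dh\<^sub>3 \<otimes> S(h\<^sub>1) h\<^sub>4\<close>\<close>

definition ad_coact :: "('a, 'o, 'h, 'w) cdata \<Rightarrow> 'w fvec \<Rightarrow> ('w \<times> 'h) fvec"
  where "ad_coact X = the_lin (coinv_forms1 X) (\<lambda>R.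
    \<forall>h. R (mc_form X h) =
      linext (\<lambda>(i, j, k, l). tens (sdif X (bas j) (bas k))
          (mul (chopf X) (antipode (chopf X) (bas i)) (bas l)))
        (comul4 (chopf X) h))"

text \<open>\<open>a da' \<mapsto> a\<^sub>0 da'\<^sub>0 \<otimes> a\<^sub>1 a'\<^sub>1\<close>\<close>

definition right_coact1 :: "('a, 'o, 'h, 'w) cdata \<Rightarrow> 'o fvec \<Rightarrow> ('o \<times> 'h) fvec"
  where "right_coact1 X = the_lin (hcomp (frm X) 1) (\<lambda>R.
    \<forall>a a'. R (mul (frm X) (emb X a) (dif (frm X) (emb X a')))
      = mul (alg_tens (frm X) (chopf X)) (tmap (emb X) id (coact X a))
          (tmap (dif (frm X) \<circ> emb X) id (coact X a')))"

text \<open>\<open>a da' \<mapsto> a a'\<^sub>0 \<otimes> S(a'\<^sub>1) da'\<^sub>2\<close>\<close>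

definition pi_ver :: "('a, 'o, 'h, 'w) cdata \<Rightarrow> 'o fvec \<Rightarrow> ('a \<times> 'w) fvec"
  where "pi_ver X = the_lin (hcomp (frm X) 1) (\<lambda>P.
    \<forall>a a'. P (mul (frm X) (emb X a) (dif (frm X) (emb X a')))
      = linext (\<lambda>(i, j, k). tens (mul (calg X) a (bas i)) (sdif X (bas j) (bas k)))
          (tmap id (comul (chopf X)) (coact X a')))"

definition connection_form :: "('a, 'o, 'h, 'w) cdata \<Rightarrow> ('w fvec \<Rightarrow> 'o fvec) \<Rightarrow> bool"
  where "connection_form X s \<longleftrightarrow> lin_on (coinv_forms1 X) s
    \<and> (\<forall>\<eta>\<in>coinv_forms1 X. s \<eta> \<in> hcomp (frm X) 1)
    \<and> (\<forall>\<eta>\<in>coinv_forms1 X. right_coact1 X (s \<eta>) = tmap_on s (ad_coact X \<eta>))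
    \<and> (\<forall>\<eta>\<in>coinv_forms1 X. pi_ver X (s \<eta>) = tens (unt (calg X)) \<eta>)"


section \<open>The noncommutative torus\<close>

definition tq :: "real \<Rightarrow> complex"
  where "tq \<theta> = exp (\<i> * of_real \<theta>)"

text \<open>
  The basis vector indexed by \<open>(m, n)\<close> is \<open>u\<^sup>m v\<^sup>n\<close>. The presentation by generators and relations is
  the universal property proved below.
\<close>

definition tor_alg :: "real \<Rightarrow> (int \<times> int) alg"
  where "tor_alg \<theta> = \<lparr>
    mul = bilext (\<lambda>(m, n) (p, r). scl (tq \<theta> powi (n * p)) (bas (m + p, n + r))),
    unt = bas (0, 0)\<rparr>"

abbreviation tor_u :: "(int \<times> int) fvec" where "tor_u \<equiv> bas (1, 0)"
abbreviation tor_v :: "(int \<times> int) fvec" where "tor_v \<equiv> bas (0, 1)"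
abbreviation tor_u_inv :: "(int \<times> int) fvec" where "tor_u_inv \<equiv> bas (-1, 0)"
abbreviation tor_v_inv :: "(int \<times> int) fvec" where "tor_v_inv \<equiv> bas (0, -1)"

text \<open>The left module generators \<open>1, du, dv, du \<and> dv\<close> and their products.\<close>

datatype tgen = T1 | Tu | Tv | Tuv

fun tgen_deg :: "tgen \<Rightarrow> nat"
  where "tgen_deg T1 = 0" | "tgen_deg Tu = 1" | "tgen_deg Tv = 1" | "tgen_deg Tuv = 2"

fun tgen_mul :: "real \<Rightarrow> tgen \<Rightarrow> tgen \<Rightarrow> tgen fvec"
  where
    "tgen_mul \<theta> T1 g = bas g"
  | "tgen_mul \<theta> f T1 = bas f"
  | "tgen_mul \<theta> Tu Tv = bas Tuv"
  | "tgen_mul \<theta> Tv Tu = scl (- tq \<theta>) (bas Tuv)"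
  | "tgen_mul \<theta> _ _ = 0"

text \<open>The scalar by which a generator commutes with \<open>u\<^sup>m v\<^sup>n\<close>: \<open>\<omega> u\<^sup>m v\<^sup>n = twist \<omega> (m, n) u\<^sup>m v\<^sup>n \<omega>\<close>.\<close>

fun tgen_twist :: "real \<Rightarrow> tgen \<Rightarrow> int \<times> int \<Rightarrow> complex"
  where
    "tgen_twist \<theta> T1 (m, n) = 1"
  | "tgen_twist \<theta> Tu (m, n) = tq \<theta> powi (- n)"
  | "tgen_twist \<theta> Tv (m, n) = tq \<theta> powi m"
  | "tgen_twist \<theta> Tuv (m, n) = tq \<theta> powi (m - n)"

definition tor_frm_mul :: "real \<Rightarrow> ((int \<times> int) \<times> tgen) fvec \<Rightarrow> ((int \<times> int) \<times> tgen) fvec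
    \<Rightarrow> ((int \<times> int) \<times> tgen) fvec"
  where "tor_frm_mul \<theta> = bilext (\<lambda>(a, f) (b, g).
    tens (mul (tor_alg \<theta>) (bas a) (scl (tgen_twist \<theta> f b) (bas b))) (tgen_mul \<theta> f g))"

text \<open>\<open>d(u\<^sup>m v\<^sup>n) = m u\<^sup>m\<^sup>-\<^sup>1 (du) v\<^sup>n + n u\<^sup>m v\<^sup>n\<^sup>-\<^sup>1 dv\<close> and \<open>d(a \<omega>) = da \<and> \<omega>\<close> for each generator \<open>\<omega>\<close>.\<close>

definition tor_frm :: "real \<Rightarrow> ((int \<times> int) \<times> tgen) dga"
  where "tor_frm \<theta> = \<lparr>
    mul = tor_frm_mul \<theta>,
    unt = bas ((0, 0), T1),
    deg = (\<lambda>(a, f). tgen_deg f),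
    dif = linext (\<lambda>((m, n), f).
      tor_frm_mul \<theta>
        (scl (of_int m * tq \<theta> powi (- n)) (bas ((m - 1, n), Tu)) + scl (of_int n) (bas ((m, n - 1), Tv)))
        (bas ((0, 0), f)))\<rparr>"

definition tor_emb :: "(int \<times> int) fvec \<Rightarrow> ((int \<times> int) \<times> tgen) fvec"
  where "tor_emb a = tens a (bas T1)"


section \<open>The circle\<close>

text \<open>The basis vector indexed by \<open>n\<close> is \<open>t\<^sup>n\<close>.\<close>

definition circ :: "int hopf"
  where "circ = \<lparr>
    mul = bilext (\<lambda>m n. bas (m + n)),
    unt = bas 0,
    comul = linext (\<lambda>n. bas (n, n)),
    counit = (\<lambda>x. \<Sum>n\<in>Poly_Mapping.keys x. Poly_Mapping.lookup x n),
    antipode = linext (\<lambda>n. bas (- n))\<rparr>"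

abbreviation circ_t :: "int fvec" where "circ_t \<equiv> bas 1"
abbreviation circ_t_inv :: "int fvec" where "circ_t_inv \<equiv> bas (-1)"

datatype cgen = C1 | Ct

fun cgen_mul :: "cgen \<Rightarrow> cgen \<Rightarrow> cgen fvec"
  where "cgen_mul C1 g = bas g" | "cgen_mul Ct C1 = bas Ct" | "cgen_mul Ct Ct = 0"

definition circ_frm :: "(int \<times> cgen) dga"
  where "circ_frm = \<lparr>
    mul = bilext (\<lambda>(m, f) (n, g). tens (bas (m + n)) (cgen_mul f g)),
    unt = bas (0, C1),
    deg = (\<lambda>(m, f). if f = C1 then 0 else 1),
    dif = linext (\<lambda>(m, f). if f = C1 then scl (of_int m) (bas (m - 1, Ct)) else 0)\<rparr>"

definition circ_emb :: "int fvec \<Rightarrow> (int \<times> cgen) fvec"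
  where "circ_emb h = tens h (bas C1)"


section \<open>The torus as a comodule algebra with calculi\<close>

definition tor_coact :: "real \<Rightarrow> (int \<times> int) fvec \<Rightarrow> ((int \<times> int) \<times> int) fvec"
  where "tor_coact \<theta> = (THE \<delta>. alg_hom (tor_alg \<theta>) (alg_tens (tor_alg \<theta>) circ) \<delta>
    \<and> \<delta> tor_u = tens tor_u circ_t \<and> \<delta> tor_v = tens tor_v circ_t_inv)"

definition torus :: "real \<Rightarrow> (int \<times> int, (int \<times> int) \<times> tgen, int, int \<times> cgen) cdata"
  where "torus \<theta> = \<lparr>
    calg = tor_alg \<theta>,
    chopf = circ,
    coact = tor_coact \<theta>,
    frm = tor_frm \<theta>,
    emb = tor_emb,
    hfrm = circ_frm,
    hemb = circ_emb\<rparr>"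

definition dt_over_t :: "(int \<times> cgen) fvec"
  where "dt_over_t = mul circ_frm (circ_emb circ_t_inv) (dif circ_frm (circ_emb circ_t))"

definition du_over_u :: "real \<Rightarrow> ((int \<times> int) \<times> tgen) fvec"
  where "du_over_u \<theta> = mul (tor_frm \<theta>) (tor_emb tor_u_inv) (dif (tor_frm \<theta>) (tor_emb tor_u))"


section \<open>Linear extension\<close>

text \<open>Otherwise \<open>bas 0\<close> would be rewritten to the unit of the convolution algebra.\<close>

declare Poly_Mapping.single_one [simp del]

lemma lin_iff: "lin f \<longleftrightarrow> (\<forall>x y. f (x + y) = f x + f y) \<and> (\<forall>c x. f (scl c x) = scl c (f x))"
  by (simp add: Vector_Spaces.linear_iff fvec.vector_space_axioms)

lemma scl_single: "scl c (Poly_Mapping.single i d) = Poly_Mapping.single i (c * d)"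
  by (auto intro!: poly_mapping_eqI simp: lookup_single when_def)

lemma fvec_expand: "x = (\<Sum>i\<in>Poly_Mapping.keys x. scl (Poly_Mapping.lookup x i) (bas i))"
  by (rule poly_mapping_eqI)
    (auto simp: scl_single lookup_sum lookup_single when_def in_keys_iff sum.delta)

lemma linext_sup:
  assumes "finite S" "Poly_Mapping.keys x \<subseteq> S"
  shows "linext f x = (\<Sum>i\<in>S. scl (Poly_Mapping.lookup x i) (f i))"
  unfolding linext_def
  by (rule sum.mono_neutral_left) (use assms in \<open>auto simp: in_keys_iff\<close>)

lemma linext_bas [simp]: "linext f (bas i) = f i"
  by (simp add: linext_def)

lemma lin_linext [simp]: "lin (linext f)"
  unfolding lin_iff
proof (intro conjI allI)
  fix x y :: "'a fvec" and c
  let ?S = "Poly_Mapping.keys x \<union> Poly_Mapping.keys y"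
  have "Poly_Mapping.keys (x + y) \<subseteq> ?S" by (rule Poly_Mapping.keys_add)
  then show "linext f (x + y) = linext f x + linext f y"
    by (simp add: linext_sup[of ?S] lookup_add fvec.scale_left_distrib sum.distrib)
  have "Poly_Mapping.keys (scl c x) \<subseteq> Poly_Mapping.keys x" by (auto simp: in_keys_iff)
  then show "linext f (scl c x) = scl c (linext f x)"
    by (simp add: linext_sup[of "Poly_Mapping.keys x"] fvec.scale_sum_right)
qed

lemma lin_add: "lin f \<Longrightarrow> f (x + y) = f x + f y"
  and lin_scl: "lin f \<Longrightarrow> f (scl c x) = scl c (f x)"
  by (simp_all add: lin_iff)

lemma lin_zero: "lin f \<Longrightarrow> f 0 = 0"
  using lin_scl[of f 0 0] by simp

lemma lin_sum: "lin f \<Longrightarrow> f (sum g A) = (\<Sum>i\<in>A. f (g i))"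
  by (induction A rule: infinite_finite_induct) (simp_all add: lin_zero lin_add)

lemma lin_expand: assumes "lin f" shows "f x = linext (\<lambda>i. f (bas i)) x"
  by (subst fvec_expand[of x]) (simp add: lin_sum[OF assms] lin_scl[OF assms] linext_def)

lemma lin_eqI: "\<lbrakk>lin f; lin g; \<And>i. f (bas i) = g (bas i)\<rbrakk> \<Longrightarrow> f x = g x"
  by (subst lin_expand, assumption, subst (2) lin_expand) simp_all

lemma lin_comp: "lin f \<Longrightarrow> lin g \<Longrightarrow> lin (\<lambda>x. f (g x))"
  by (simp add: lin_iff)

lemma lin_id [simp]: "lin (\<lambda>x. x)" "lin id"
  by (simp_all add: lin_iff)

lemma lin_scale: "lin f \<Longrightarrow> lin (\<lambda>x. scl c (f x))"
  by (simp add: lin_iff fvec.scale_right_distrib mult.commute)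

lemma lin_plus: "lin f \<Longrightarrow> lin g \<Longrightarrow> lin (\<lambda>x. f x + g x)"
  by (simp add: lin_iff fvec.scale_right_distrib algebra_simps)

lemma lin_linext_param: "(\<And>i. lin (\<lambda>y. f y i)) \<Longrightarrow> lin (\<lambda>y. linext (f y) x)"
  by (simp add: lin_iff linext_def fvec.scale_right_distrib sum.distrib fvec.scale_sum_right mult.commute)

lemma bilin_bilext [simp]: "bilin (bilext f)"
  unfolding bilin_def bilext_def
  by (auto intro!: lin_linext_param)

lemma bilext_bas [simp]: "bilext f (bas i) (bas j) = f i j"
  by (simp add: bilext_def)

lemma bilinD: "bilin f \<Longrightarrow> lin (f x)" "bilin f \<Longrightarrow> lin (\<lambda>x. f x y)"
  by (simp_all add: bilin_def)

lemma bilin_compR: "bilin f \<Longrightarrow> lin g \<Longrightarrow> lin (\<lambda>z. f x (g z))"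
  using lin_comp[of "f x" g] by (simp add: bilin_def)

lemma bilin_compL: "bilin f \<Longrightarrow> lin g \<Longrightarrow> lin (\<lambda>z. f (g z) y)"
  using lin_comp[of "\<lambda>x. f x y" g] by (simp add: bilin_def)

lemma bilinI: "(\<And>x. lin (f x)) \<Longrightarrow> (\<And>y. lin (\<lambda>x. f x y)) \<Longrightarrow> bilin f"
  by (simp add: bilin_def)

lemma bilin_eqI:
  assumes f: "bilin f" and g: "bilin g" and e: "\<And>i j. f (bas i) (bas j) = g (bas i) (bas j)"
  shows "f x y = g x y"
proof -
  have "f (bas i) y = g (bas i) y" for i
    by (rule lin_eqI[of "f (bas i)" "g (bas i)", OF bilinD(1)[OF f] bilinD(1)[OF g] e])
  from lin_eqI[of "\<lambda>x. f x y" "\<lambda>x. g x y", OF bilinD(2)[OF f] bilinD(2)[OF g] this]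
  show ?thesis .
qed

lemma bilin_simps:
  assumes "bilin f"
  shows "f (x + x') y = f x y + f x' y" "f x (y + y') = f x y + f x y'"
    "f (scl c x) y = scl c (f x y)" "f x (scl c y) = scl c (f x y)" "f 0 y = 0" "f x 0 = 0"
    "f (sum h A) y = (\<Sum>i\<in>A. f (h i) y)" "f x (sum h' A) = (\<Sum>i\<in>A. f x (h' i))"
  using lin_add[OF bilinD(2)[OF assms]] lin_add[OF bilinD(1)[OF assms]]
    lin_scl[OF bilinD(2)[OF assms]] lin_scl[OF bilinD(1)[OF assms]]
    lin_zero[OF bilinD(2)[OF assms]] lin_zero[OF bilinD(1)[OF assms]]
    lin_sum[OF bilinD(2)[OF assms]] lin_sum[OF bilinD(1)[OF assms]]
  by blast+

lemma bilin_tens [simp]: "bilin tens"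
  by (simp add: tens_def)

lemmas tens_simps = bilin_simps[OF bilin_tens]

lemma tens_bas [simp]: "tens (bas i) (bas j) = bas (i, j)"
  by (simp add: tens_def)

lemma lin_tmap [simp]: "lin (tmap f g)"
  by (simp add: tmap_def)

lemma tmap_bas [simp]: "tmap f g (bas (i, j)) = tens (f (bas i)) (g (bas j))"
  by (simp add: tmap_def)

lemma tmap_tens:
  assumes "lin f" "lin g"
  shows "tmap f g (tens x y) = tens (f x) (g y)"
proof (rule bilin_eqI[of "\<lambda>x y. tmap f g (tens x y)" "\<lambda>x y. tens (f x) (g y)"])
  show "bilin (\<lambda>x y. tmap f g (tens x y))"
    by (intro bilinI lin_comp[OF lin_tmap] bilinD[OF bilin_tens])
  show "bilin (\<lambda>x y. tens (f x) (g y))"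
    by (intro bilinI bilin_compL[OF bilin_tens] bilin_compR[OF bilin_tens] assms)
qed simp

lemma trilin_eqI:
  assumes "\<And>y z. lin (\<lambda>x. f x y z)" "\<And>x z. lin (\<lambda>y. f x y z)" "\<And>x y. lin (f x y)"
    and "\<And>y z. lin (\<lambda>x. g x y z)" "\<And>x z. lin (\<lambda>y. g x y z)" "\<And>x y. lin (g x y)"
    and "\<And>i j k. f (bas i) (bas j) (bas k) = g (bas i) (bas j) (bas k)"
  shows "f x y z = g x y z"
proof -
  have "f (bas i) y z = g (bas i) y z" for i
    by (rule bilin_eqI[of "f (bas i)" "g (bas i)"]) (simp_all only: bilin_def assms simp_thms)
  from lin_eqI[of "\<lambda>x. f x y z" "\<lambda>x. g x y z", OF assms(1) assms(4) this]
  show ?thesis .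
qed

lemma assocI:
  assumes "bilin m" "\<And>i j k. m (m (bas i) (bas j)) (bas k) = m (bas i) (m (bas j) (bas k))"
  shows "m (m x y) z = m x (m y z)"
proof (rule trilin_eqI[of "\<lambda>x y z. m (m x y) z" "\<lambda>x y z. m x (m y z)"])
  note l = bilinD[OF assms(1)]
  show "lin (\<lambda>x. m (m x y) z)" "lin (\<lambda>y. m (m x y) z)" "lin (m (m x y))"
    "lin (\<lambda>x. m x (m y z))" "lin (\<lambda>y. m x (m y z))" "lin (\<lambda>z. m x (m y z))" for x y z
    by (rule lin_comp[OF l(2) l(2)] lin_comp[OF l(2) l(1)] l lin_comp[OF l(1) l(2)] lin_comp[OF l(1) l(1)])+
qed (rule assms)

lemma unitI:
  assumes b: "bilin m" and e: "\<And>i. m e (bas i) = bas i" "\<And>i. m (bas i) e = bas i"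
  shows "m e x = x" "m x e = x"
  by (rule lin_eqI[of "m e" "\<lambda>x. x", OF bilinD(1)[OF b] lin_id(1) e(1)],
      rule lin_eqI[of "\<lambda>x. m x e" "\<lambda>x. x", OF bilinD(2)[OF b] lin_id(1) e(2)])

lemma is_algI:
  assumes b: "bilin (mul R)"
    and "\<And>i j k. mul R (mul R (bas i) (bas j)) (bas k) = mul R (bas i) (mul R (bas j) (bas k))"
    and "\<And>i. mul R (unt R) (bas i) = bas i" "\<And>i. mul R (bas i) (unt R) = bas i"
  shows "is_alg R"
  unfolding is_alg_def
  by (intro conjI allI b assocI[OF b assms(2)] unitI[OF b assms(3,4)])

lemma alg_homI:
  assumes R: "bilin (mul R)" and S: "bilin (mul S)" and f: "lin f" and "f (unt R) = unt S"
    and e: "\<And>i j. f (mul R (bas i) (bas j)) = mul S (f (bas i)) (f (bas j))"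
  shows "alg_hom R S f"
  unfolding alg_hom_def
proof (intro conjI allI assms)
  fix x y
  show "f (mul R x y) = mul S (f x) (f y)"
    by (rule bilin_eqI[of "\<lambda>x y. f (mul R x y)" "\<lambda>x y. mul S (f x) (f y)"])
      (intro bilinI lin_comp[OF f] bilinD[OF R] bilin_compL[OF S] bilin_compR[OF S] f e)+
qed

lemma bilin_alg_tens [simp]: "bilin (mul (alg_tens R S))"
  by (simp add: alg_tens_def)

lemma alg_tens_mul:
  assumes R: "bilin (mul R)" and S: "bilin (mul S)"
  shows "mul (alg_tens R S) (tens x y) (tens z w) = tens (mul R x z) (mul S y w)"
proof -
  let ?m = "mul (alg_tens R S)"
  note i = bilinI bilin_compL[OF bilin_alg_tens[of R S]] bilin_compR[OF bilin_alg_tens[of R S]]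
    bilinD[OF bilin_tens] bilin_compL[OF bilin_tens] bilin_compR[OF bilin_tens] bilinD[OF R] bilinD[OF S]
  have 1: "?m (tens (bas i) (bas j)) (tens z w) = tens (mul R (bas i) z) (mul S (bas j) w)" for i j
    by (rule bilin_eqI[of "\<lambda>z w. ?m (tens (bas i) (bas j)) (tens z w)"
          "\<lambda>z w. tens (mul R (bas i) z) (mul S (bas j) w)"]) (intro i, intro i, simp add: alg_tens_def)
  show ?thesis
    by (rule bilin_eqI[of "\<lambda>x y. ?m (tens x y) (tens z w)"
          "\<lambda>x y. tens (mul R x z) (mul S y w)"]) (intro i, intro i, rule 1)
qed

lemma is_alg_tens: assumes "is_alg R" "is_alg S" shows "is_alg (alg_tens R S)"
proof (rule is_algI)
  have b: "bilin (mul R)" "bilin (mul S)" using assms by (auto simp: is_alg_def)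
  note m = alg_tens_mul[OF b]
  fix i j k :: "'a \<times> 'c"
  obtain i1 i2 j1 j2 k1 k2 where "i = (i1, i2)" "j = (j1, j2)" "k = (k1, k2)"
    by (metis surj_pair)
  then have e: "bas i = tens (bas i1) (bas i2)" "bas j = tens (bas j1) (bas j2)"
    "bas k = tens (bas k1) (bas k2)" by auto
  show "mul (alg_tens R S) (mul (alg_tens R S) (bas i) (bas j)) (bas k)
      = mul (alg_tens R S) (bas i) (mul (alg_tens R S) (bas j) (bas k))"
    unfolding e m using assms by (simp add: is_alg_def)
  have u: "unt (alg_tens R S) = tens (unt R) (unt S)" by (simp add: alg_tens_def)
  show "mul (alg_tens R S) (unt (alg_tens R S)) (bas i) = bas i"
    "mul (alg_tens R S) (bas i) (unt (alg_tens R S)) = bas i"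
    unfolding e m u using assms by (simp_all add: is_alg_def)
qed simp


section \<open>Graded spaces and calculi\<close>

lemma subspace_hcomp: fixes W :: "('a, 'r) dga_scheme" shows "fvec.subspace (hcomp W k)"
  unfolding hcomp_def
proof (rule fvec.subspaceI)
  fix x y :: "'a fvec" assume "x \<in> {x. \<forall>i\<in>Poly_Mapping.keys x. deg W i = k}" "y \<in> {x. \<forall>i\<in>Poly_Mapping.keys x. deg W i = k}"
  then show "x + y \<in> {x. \<forall>i\<in>Poly_Mapping.keys x. deg W i = k}"
    using Poly_Mapping.keys_add[of x y] by blast
qed (auto simp: in_keys_iff)

lemma bas_hcomp: "bas i \<in> hcomp W (deg W i)"
  by (simp add: hcomp_def)

lemma hcomp_image:
  assumes "lin f" "fvec.subspace V" "x \<in> hcomp W k" "\<And>i. deg W i = k \<Longrightarrow> f (bas i) \<in> V"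
  shows "f x \<in> V"
  unfolding lin_expand[OF assms(1), of x] linext_def
  by (intro fvec.subspace_sum fvec.subspace_scale assms(2,4)) (use assms(3) in \<open>auto simp: hcomp_def\<close>)

lemma hcomp_eqI:
  assumes "lin f" "lin g" "x \<in> hcomp W k" "\<And>i. deg W i = k \<Longrightarrow> f (bas i) = g (bas i)"
  shows "f x = g x"
  unfolding lin_expand[OF assms(1), of x] lin_expand[OF assms(2), of x] linext_def
  by (rule sum.cong) (use assms(3,4) in \<open>auto simp: hcomp_def\<close>)

lemma is_dgaI:
  assumes A: "is_alg W" and u: "unt W \<in> hcomp W 0"
    and m: "\<And>i j. mul W (bas i) (bas j) \<in> hcomp W (deg W i + deg W j)"
    and d: "lin (dif W)" "\<And>i. dif W (bas i) \<in> hcomp W (Suc (deg W i))" "\<And>i. dif W (dif W (bas i)) = 0"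
    and l: "\<And>i j. dif W (mul W (bas i) (bas j))
      = mul W (dif W (bas i)) (bas j) + scl ((-1) ^ deg W i) (mul W (bas i) (dif W (bas j)))"
  shows "is_dga W"
  unfolding is_dga_def
proof (intro conjI allI ballI A u d(1))
  have b: "bilin (mul W)" using A by (simp add: is_alg_def)
  fix k
  { fix l x y assume x: "x \<in> hcomp W k" and y: "y \<in> hcomp W l"
    have "mul W (bas i) y \<in> hcomp W (k + l)" if "deg W i = k" for i
      by (rule hcomp_image[OF bilinD(1)[OF b] subspace_hcomp y]) (use m[of i] that in auto)
    then show "mul W x y \<in> hcomp W (k + l)"
      by (rule hcomp_image[OF bilinD(2)[OF b] subspace_hcomp x]) }
  { fix x assume x: "x \<in> hcomp W k"
    show "dif W x \<in> hcomp W (Suc k)"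
      by (rule hcomp_image[OF d(1) subspace_hcomp x]) (use d(2) in auto) }
  { fix x y assume x: "x \<in> hcomp W k"
    note i = lin_comp[OF d(1)] lin_plus lin_scale bilin_compL[OF b] bilin_compR[OF b] lin_id(1)
    let ?R = "\<lambda>x y. mul W (dif W x) y + scl ((-1) ^ k) (mul W x (dif W y))"
    have *: "dif W (mul W (bas i) y) = ?R (bas i) y" if k: "deg W i = k" for i
    proof (rule lin_eqI[of "\<lambda>y. dif W (mul W (bas i) y)" "\<lambda>y. ?R (bas i) y"])
      show "dif W (mul W (bas i) (bas j)) = ?R (bas i) (bas j)" for j
        using l[of i j] unfolding k .
    qed (intro i)+
    show "dif W (mul W x y) = ?R x y"
      by (rule hcomp_eqI[of "\<lambda>x. dif W (mul W x y)" "\<lambda>x. ?R x y", OF _ _ x *])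
        (intro i, intro i) }
next
  have "lin (\<lambda>x. dif W (dif W x))" by (rule lin_comp[OF d(1) d(1)])
  moreover have "lin (\<lambda>x. 0 :: 'a fvec)" by (simp add: lin_iff)
  ultimately show "dif W (dif W x) = 0" for x
    by (rule lin_eqI[of "\<lambda>x. dif W (dif W x)" "\<lambda>x. 0"]) (rule d(3))
qed

lemma bij_linext_bas:
  assumes g: "inj g"
  shows "bij_betw (linext (\<lambda>i. bas (g i))) UNIV {x. Poly_Mapping.keys x \<subseteq> range g}"
proof (intro bij_betw_byWitness[where f' = "linext (\<lambda>i. bas (inv g i))"] ballI subsetI)
  let ?f = "linext (\<lambda>i. bas (g i))" and ?f' = "linext (\<lambda>i. bas (inv g i))"
  show "?f' (?f x) = x" for x
    by (rule lin_eqI[of "\<lambda>x. ?f' (?f x)" "\<lambda>x. x"]) (simp_all add: lin_comp[OF lin_linext lin_linext] g)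
  show "?f (?f' y) = y" if "y \<in> {x. Poly_Mapping.keys x \<subseteq> range g}" for y
  proof -
    have "?f (?f' y) = (\<Sum>i\<in>Poly_Mapping.keys y. scl (Poly_Mapping.lookup y i) (?f (?f' (bas i))))"
      unfolding lin_expand[OF lin_comp[OF lin_linext lin_linext], of _ _ y] by (simp add: linext_def)
    also have "\<dots> = (\<Sum>i\<in>Poly_Mapping.keys y. scl (Poly_Mapping.lookup y i) (bas i))"
      by (rule sum.cong) (use that in \<open>auto simp: f_inv_into_f\<close>)
    finally show ?thesis by (simp flip: fvec_expand)
  qed
  have "fvec.subspace {x :: 'b fvec. Poly_Mapping.keys x \<subseteq> range g}"
  proof (rule fvec.subspaceI)
    fix x y :: "'b fvec" assume "x \<in> {x. Poly_Mapping.keys x \<subseteq> range g}" "y \<in> {x. Poly_Mapping.keys x \<subseteq> range g}"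
    then show "x + y \<in> {x. Poly_Mapping.keys x \<subseteq> range g}"
      using Poly_Mapping.keys_add[of x y] by blast
  qed (auto simp: in_keys_iff)
  then have "?f x \<in> {x. Poly_Mapping.keys x \<subseteq> range g}" for x
    unfolding linext_def by (intro fvec.subspace_sum fvec.subspace_scale) auto
  then show "y \<in> {x. Poly_Mapping.keys x \<subseteq> range g}" if "y \<in> ?f ` UNIV" for y
    using that by blast
qed simp

lemma lin_tens_bas: "(\<lambda>a. tens a (bas g)) = linext (\<lambda>i. bas (i, g))"
  by (rule ext, rule lin_eqI) (auto simp: bilinD)

lemma form_hcomp:
  assumes W: "is_dga W" and e: "range e \<subseteq> hcomp W 0"
  shows "form W e a bs \<in> hcomp W (length bs)"
proof (induction bs rule: rev_induct)
  case Nil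
  show ?case using e by (auto simp: form_def)
next
  case (snoc b bs)
  have "e b \<in> hcomp W 0" using e by blast
  then have "dif W (e b) \<in> hcomp W (Suc 0)" using W unfolding is_dga_def by blast
  with W snoc.IH have "mul W (form W e a bs) (dif W (e b)) \<in> hcomp W (length bs + Suc 0)"
    unfolding is_dga_def by blast
  then show ?case by (simp add: form_def)
qed

lemma is_calculusI:
  assumes W: "is_dga W" and e: "e = (\<lambda>a. tens a (bas g))" "alg_hom A W e"
    and z: "\<And>i f. deg W (i, f) = 0 \<longleftrightarrow> f = g"
    and s: "\<And>i. bas i \<in> {form W e a bs |a bs. length bs = deg W i}"
  shows "is_calculus A W e"
proof -
  have "hcomp W 0 = {x. Poly_Mapping.keys x \<subseteq> range (\<lambda>i. (i, g))}"
    using z by (force simp: hcomp_def)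
  then have b: "bij_betw e UNIV (hcomp W 0)"
    using bij_linext_bas[of "\<lambda>i. (i, g)"] by (simp add: e(1) lin_tens_bas inj_def)
  then have r: "range e \<subseteq> hcomp W 0" by (simp add: bij_betw_def)
  have "hcomp W k = fvec.span {form W e a bs |a bs. length bs = k}" for k
  proof
    show "hcomp W k \<subseteq> fvec.span {form W e a bs |a bs. length bs = k}"
    proof
      fix x assume x: "x \<in> hcomp W k"
      show "x \<in> fvec.span {form W e a bs |a bs. length bs = k}"
        by (rule hcomp_image[OF lin_id(1) fvec.subspace_span x], rule fvec.span_base) (use s in blast)
    qed
    show "fvec.span {form W e a bs |a bs. length bs = k} \<subseteq> hcomp W k"
      by (rule fvec.span_minimal) (use form_hcomp[OF W r] subspace_hcomp in auto)
  qed
  with W e b show ?thesis by (simp add: is_calculus_def)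
qed

lemma ext_coact_unique:
  assumes X: "is_calculus (calg X) (frm X) (emb X)" and F: "extends_coact X F" and G: "extends_coact X G"
  shows "F = G"
proof
  have lin: "lin F" "lin G" using F G by (auto simp: extends_coact_def dga_hom_def alg_hom_def)
  have eq: "F (form (frm X) (emb X) a bs) = G (form (frm X) (emb X) a bs)" for a bs
  proof (induction bs rule: rev_induct)
    case Nil
    have "H (form (frm X) (emb X) a []) = tmap (emb X) (hemb X) (coact X a)"
      if "extends_coact X H" for H
      using that unfolding extends_coact_def form_def by simp
    from this[OF F] this[OF G] show ?case by (rule trans[OF _ sym])
  next
    case (snoc b bs)
    have *: "H (form (frm X) (emb X) a (bs @ [b])) = mul (dga_tens (frm X) (hfrm X))
        (H (form (frm X) (emb X) a bs)) (dif (dga_tens (frm X) (hfrm X)) (tmap (emb X) (hemb X) (coact X b)))"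
      if "extends_coact X H" for H
    proof -
      have "H (mul (frm X) x y) = mul (dga_tens (frm X) (hfrm X)) (H x) (H y)"
        "H (dif (frm X) x) = dif (dga_tens (frm X) (hfrm X)) (H x)"
        "H (emb X b) = tmap (emb X) (hemb X) (coact X b)" for x y
        using that unfolding extends_coact_def dga_hom_def alg_hom_def by blast+
      then show ?thesis by (simp only: form_def foldl_append foldl_Cons foldl_Nil)
    qed
    show ?case by (simp only: *[OF F] *[OF G] snoc.IH)
  qed
  have 1: "F x = G x" if "x \<in> fvec.span {form (frm X) (emb X) a bs |a bs. length bs = k}" for x k
    using that
  proof (induction rule: fvec.span_induct_alt)
    case base
    show ?case by (simp add: lin_zero[OF lin(1)] lin_zero[OF lin(2)])
  next
    case (step c x y)
    from step.hyps have "F x = G x" using eq by blast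
    with step show ?case by (simp add: lin_add[OF lin(1)] lin_add[OF lin(2)] lin_scl[OF lin(1)] lin_scl[OF lin(2)])
  qed
  have 2: "bas i \<in> fvec.span {form (frm X) (emb X) a bs |a bs. length bs = deg (frm X) i}" for i
    using X bas_hcomp[of i "frm X"] unfolding is_calculus_def by blast
  show "F x = G x" for x
    by (rule lin_eqI[OF lin]) (rule 1[OF 2])
qed

lemma ext_coact_eq:
  "is_calculus (calg X) (frm X) (emb X) \<Longrightarrow> extends_coact X F \<Longrightarrow> ext_coact X = F"
  unfolding ext_coact_def by (blast intro: ext_coact_unique)

section \<open>The universal property of the torus\<close>

text \<open>
  The algebra has the invertible elements \<open>u\<close>, \<open>v\<close> with \<open>v u = exp(\<i> \<theta>) u v\<close>, and it is universal
  with respect to this relation, i.e. it is the quotient of the algebra of noncommutative Laurent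
  polynomials by the ideal generated by it.
\<close>

lemma tq_nz [simp]: "tq \<theta> \<noteq> 0" by (simp add: tq_def)

lemma bilin_tor_alg [simp]: "bilin (mul (tor_alg \<theta>))" by (simp add: tor_alg_def)

lemma tor_alg_mul [simp]:
  "mul (tor_alg \<theta>) (bas (m, n)) (bas (p, r)) = scl (tq \<theta> powi (n * p)) (bas (m + p, n + r))"
  by (simp add: tor_alg_def)

lemma tor_alg_is_alg: "is_alg (tor_alg \<theta>)"
proof (rule is_algI)
  fix i j k :: "int \<times> int"
  show "mul (tor_alg \<theta>) (mul (tor_alg \<theta>) (bas i) (bas j)) (bas k)
      = mul (tor_alg \<theta>) (bas i) (mul (tor_alg \<theta>) (bas j) (bas k))"
    by (cases i; cases j; cases k)
      (simp add: bilin_simps power_int_add algebra_simps)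
  show "mul (tor_alg \<theta>) (unt (tor_alg \<theta>)) (bas i) = bas i"
    "mul (tor_alg \<theta>) (bas i) (unt (tor_alg \<theta>)) = bas i"
    by (cases i; simp add: tor_alg_def)+
qed simp

definition apow :: "('i, 'r) alg_scheme \<Rightarrow> 'i fvec \<Rightarrow> nat \<Rightarrow> 'i fvec"
  where "apow R x n = ((mul R x) ^^ n) (unt R)"

definition zpow :: "('i, 'r) alg_scheme \<Rightarrow> 'i fvec \<Rightarrow> 'i fvec \<Rightarrow> int \<Rightarrow> 'i fvec"
  where "zpow R x y m = (if 0 \<le> m then apow R x (nat m) else apow R y (nat (- m)))"

lemma zpow_step:
  assumes R: "is_alg R" and inv: "mul R x y = unt R" "mul R y x = unt R"
  shows "zpow R x y 0 = unt R" "mul R x (zpow R x y m) = zpow R x y (m + 1)"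
    "mul R y (zpow R x y m) = zpow R x y (m - 1)"
proof -
  have c: "mul R x (mul R y z) = z" "mul R y (mul R x z) = z" for z
    using R inv unfolding is_alg_def by metis+
  show "zpow R x y 0 = unt R" by (simp add: zpow_def apow_def)
  show "mul R x (zpow R x y m) = zpow R x y (m + 1)"
  proof (cases "m \<ge> 0")
    case True then show ?thesis by (simp add: zpow_def apow_def nat_add_distrib)
  next
    case False
    then have "nat (- m) = Suc (nat (- (m + 1)))" by simp
    with False c show ?thesis by (auto simp: zpow_def apow_def)
  qed
  show "mul R y (zpow R x y m) = zpow R x y (m - 1)"
  proof (cases "m \<ge> 1")
    case True
    then have "nat m = Suc (nat (m - 1))" by simp
    with True c show ?thesis by (auto simp: zpow_def apow_def)
  next
    case False
    then have "nat (- (m - 1)) = Suc (nat (- m))" by simp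
    with False inv R show ?thesis by (cases "m = 0") (auto simp: zpow_def apow_def is_alg_def)
  qed
qed

lemma int_steps:
  fixes f g :: "int \<Rightarrow> 'b"
  assumes "f 0 = g 0" "\<And>m. f (m + 1) = up (f m)" "\<And>m. g (m + 1) = up (g m)"
    "\<And>m. f (m - 1) = dn (f m)" "\<And>m. g (m - 1) = dn (g m)"
  shows "f m = g m"
  by (induction m rule: int_induct[of _ 0]) (simp_all add: assms)

lemma tor_alg_relations:
  "mul (tor_alg \<theta>) tor_v tor_u = scl (exp (\<i> * of_real \<theta>)) (mul (tor_alg \<theta>) tor_u tor_v)"
  "mul (tor_alg \<theta>) tor_u tor_u_inv = unt (tor_alg \<theta>)" "mul (tor_alg \<theta>) tor_u_inv tor_u = unt (tor_alg \<theta>)"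
  "mul (tor_alg \<theta>) tor_v tor_v_inv = unt (tor_alg \<theta>)" "mul (tor_alg \<theta>) tor_v_inv tor_v = unt (tor_alg \<theta>)"
  by (simp_all, simp_all add: tor_alg_def tq_def)

theorem tor_alg_universal:
  fixes R :: "('i, 'r) alg_scheme"
  assumes R: "is_alg R"
    and inv: "mul R U U' = unt R" "mul R U' U = unt R" "mul R V V' = unt R" "mul R V' V = unt R"
    and rel: "mul R V U = scl (tq \<theta>) (mul R U V)"
  shows "\<exists>!f. alg_hom (tor_alg \<theta>) R f \<and> f tor_u = U \<and> f tor_v = V"
proof (rule ex1I)
  note bl = bilin_simps[of "mul R"]
  have b [simp]: "bilin (mul R)" and as: "\<And>x y z. mul R (mul R x y) z = mul R x (mul R y z)"
    and un [simp]: "\<And>x. mul R (unt R) x = x" "\<And>x. mul R x (unt R) = x" using R by (auto simp: is_alg_def)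
  have ca: "mul R U (mul R U' z) = z" "mul R U' (mul R U z) = z" "mul R V (mul R V' z) = z"
     "mul R V' (mul R V z) = z" for z
    using inv by (simp_all flip: as)
  let ?a = "zpow R U U'" and ?b = "zpow R V V'"
  note a = zpow_step[OF R inv(1,2)] and b' = zpow_step[OF R inv(3,4)]
  define f where "f = linext (\<lambda>(m, n). mul R (?a m) (?b n))"
  have VU: "mul R V (mul R U z) = scl (tq \<theta>) (mul R U (mul R V z))" for z
    using arg_cong[OF rel, of "\<lambda>x. mul R x z"] by (simp add: as bl)
  have VU': "mul R V (mul R U' z) = scl (inverse (tq \<theta>)) (mul R U' (mul R V z))" for z
    using arg_cong[OF VU[of "mul R U' z"], of "\<lambda>x. scl (inverse (tq \<theta>)) (mul R U' x)"]
    by (simp add: ca bl)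
  have Va: "mul R V (mul R (?a p) z) = scl (tq \<theta> powi p) (mul R (?a p) (mul R V z))" for p z
  proof (rule int_steps[where up = "\<lambda>x. scl (tq \<theta>) (mul R U x)" and dn = "\<lambda>x. scl (inverse (tq \<theta>)) (mul R U' x)"])
    show "mul R V (mul R (?a (m + 1)) z) = scl (tq \<theta>) (mul R U (mul R V (mul R (?a m) z)))" for m
      by (simp flip: a add: as VU)
    show "mul R V (mul R (?a (m - 1)) z) = scl (inverse (tq \<theta>)) (mul R U' (mul R V (mul R (?a m) z)))" for m
      by (simp flip: a add: as VU')
  qed (simp_all flip: a(2,3) add: a(1) as bl power_int_add power_int_diff field_simps)
  have Va': "mul R V' (mul R (?a p) z) = scl (tq \<theta> powi (-p)) (mul R (?a p) (mul R V' z))" for p z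
    using arg_cong[OF Va[of p "mul R V' z"], of "\<lambda>x. scl (tq \<theta> powi (- p)) (mul R V' x)"]
    by (simp add: ca bl flip: power_int_add)
  have ba: "mul R (?b n) (mul R (?a p) z) = scl (tq \<theta> powi (n * p)) (mul R (?a p) (mul R (?b n) z))" for n p z
    by (rule int_steps[where up = "\<lambda>x. mul R V x" and dn = "\<lambda>x. mul R V' x"])
      (simp_all flip: b'(2,3) add: b'(1) as bl Va Va' power_int_add power_int_diff algebra_simps power_int_minus divide_inverse)
  have aS: "?a (m + 1 + p) = mul R U (?a (m + p))" "?a (m - 1 + p) = mul R U' (?a (m + p))" for m p
    using a(2)[of "m + p"] a(3)[of "m + p"] by (simp_all add: algebra_simps)
  have aa: "mul R (?a m) (?a p) = ?a (m + p)" for m p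
    by (rule int_steps[where f = "\<lambda>m. mul R (?a m) (?a p)" and g = "\<lambda>m. ?a (m + p)"
          and up = "\<lambda>x. mul R U x" and dn = "\<lambda>x. mul R U' x"])
      (simp_all only: aS, simp add: a(1), simp_all only: as flip: a(2,3))
  have bS: "?b (m + 1 + p) = mul R V (?b (m + p))" "?b (m - 1 + p) = mul R V' (?b (m + p))" for m p
    using b'(2)[of "m + p"] b'(3)[of "m + p"] by (simp_all add: algebra_simps)
  have bb: "mul R (?b m) (?b p) = ?b (m + p)" for m p
    by (rule int_steps[where f = "\<lambda>m. mul R (?b m) (?b p)" and g = "\<lambda>m. ?b (m + p)"
          and up = "\<lambda>x. mul R V x" and dn = "\<lambda>x. mul R V' x"])
      (simp_all only: bS, simp add: b'(1), simp_all only: as flip: b'(2,3))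
  have aa3: "mul R (?a m) (mul R (?a p) z) = mul R (?a (m + p)) z" for m p z
    by (simp flip: as add: aa)
  have fl: "lin f" by (simp add: f_def)
  have u1: "?a 1 = U" "?b 1 = V" using a(2)[of 0] b'(2)[of 0] by (simp_all add: a(1) b'(1))
  have "alg_hom (tor_alg \<theta>) R f"
  proof (rule alg_homI)
    show "f (unt (tor_alg \<theta>)) = unt R" by (simp add: f_def tor_alg_def a b')
    show "f (mul (tor_alg \<theta>) (bas i) (bas j)) = mul R (f (bas i)) (f (bas j))" for i j
      by (cases i; cases j) (simp add: lin_scl[OF fl], simp add: f_def as ba bl bb aa3)
  qed (simp_all add: fl)
  then show "alg_hom (tor_alg \<theta>) R f \<and> f tor_u = U \<and> f tor_v = V"
    by (simp add: f_def u1 a b')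
  fix g
  assume g: "alg_hom (tor_alg \<theta>) R g \<and> g tor_u = U \<and> g tor_v = V"
  then have gl: "lin g" and gm: "\<And>x y. g (mul (tor_alg \<theta>) x y) = mul R (g x) (g y)"
    and g1: "g (bas (0, 0)) = unt R" by (auto simp: alg_hom_def tor_alg_def)
  have gu: "g tor_u_inv = U'"
  proof -
    have "mul R U (g tor_u_inv) = unt R"
      using gm[of tor_u tor_u_inv] g g1 by simp
    then show ?thesis using ca(2)[of "g tor_u_inv"] by simp
  qed
  have gv: "g tor_v_inv = V'"
  proof -
    have "mul R V (g tor_v_inv) = unt R"
      using gm[of tor_v tor_v_inv] g g1 by simp
    then show ?thesis using ca(4)[of "g tor_v_inv"] by simp
  qed
  have ga: "g (bas (m, 0)) = ?a m" for m
    by (rule int_steps[where up = "\<lambda>x. mul R U x" and dn = "\<lambda>x. mul R U' x"])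
      (use g g1 gm[of tor_u "bas (_, 0)"] gm[of tor_u_inv "bas (_, 0)"] gu in \<open>simp_all add: a add.commute\<close>)
  have gb: "g (bas (0, n)) = ?b n" for n
    by (rule int_steps[where up = "\<lambda>x. mul R V x" and dn = "\<lambda>x. mul R V' x"])
      (use g g1 gm[of tor_v "bas (0, _)"] gm[of tor_v_inv "bas (0, _)"] gv in \<open>simp_all add: b' add.commute\<close>)
  show "g = f"
  proof
    fix x show "g x = f x"
    proof (rule lin_eqI[OF gl fl])
      fix i show "g (bas i) = f (bas i)"
        by (cases i) (use gm[of "bas (fst i, 0)" "bas (0, snd i)"] in \<open>simp add: f_def ga gb\<close>)
    qed
  qed
qed

section \<open>The circle with its calculus\<close>

lemma counit_sup:
  assumes "finite S" "Poly_Mapping.keys x \<subseteq> S"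
  shows "counit circ x = (\<Sum>n\<in>S. Poly_Mapping.lookup x n)"
  unfolding circ_def hopf.simps
  by (rule sum.mono_neutral_left) (use assms in \<open>auto simp: in_keys_iff\<close>)

lemma counit_add: "counit circ (x + y) = counit circ x + counit circ y"
  using Poly_Mapping.keys_add[of x y]
  by (simp add: counit_sup[of "Poly_Mapping.keys x \<union> Poly_Mapping.keys y"] lookup_add sum.distrib)

lemma counit_scl: "counit circ (scl c x) = c * counit circ x"
proof -
  have "Poly_Mapping.keys (scl c x) \<subseteq> Poly_Mapping.keys x" by (auto simp: in_keys_iff)
  then show ?thesis by (simp add: counit_sup[of "Poly_Mapping.keys x"] sum_distrib_left)
qed

lemma counit_bas [simp]: "counit circ (bas n) = 1"
  by (simp add: circ_def)

lemma lin_counit: "lin f \<Longrightarrow> lin (\<lambda>x. scl (counit circ (f x)) y)"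
  by (simp add: lin_iff counit_add counit_scl fvec.scale_left_distrib)

lemma bilin_circ [simp]: "bilin (mul circ)" by (simp add: circ_def)
lemma circ_mul [simp]: "mul circ (bas m) (bas n) = bas (m + n)" by (simp add: circ_def)
lemma circ_unt: "unt circ = bas 0" by (simp add: circ_def)
lemma lin_circ [simp]: "lin (comul circ)" "lin (antipode circ)" by (simp_all add: circ_def)
lemma circ_bas [simp]: "comul circ (bas n) = bas (n, n)" "antipode circ (bas n) = bas (- n)"
  by (simp_all add: circ_def)

lemma circ_is_alg: "is_alg circ"
  by (rule is_algI) (simp_all add: circ_unt add.assoc)

lemma alg_tens_bas:
  "mul (alg_tens R S) (bas (i, j)) (bas (k, l)) = tens (mul R (bas i) (bas k)) (mul S (bas j) (bas l))"
  by (simp add: alg_tens_def)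

lemma circ_is_hopf: "is_hopf circ"
proof -
  note [simp] = circ_is_alg bilinD[OF bilin_circ]
  have hom: "alg_hom circ (alg_tens circ circ) (comul circ)"
    by (rule alg_homI) (simp_all add: circ_unt alg_tens_def)
  have coas: "tmap id (comul circ) (comul circ h)
      = linext (\<lambda>((i, j), k). bas (i, j, k)) (tmap (comul circ) id (comul circ h))" for h
    by (rule lin_eqI) (simp_all add: lin_comp[of "tmap _ _"] lin_comp[of "linext _"])
  have cm: "counit circ (mul circ x y) = counit circ x * counit circ y" for x y
  proof -
    have "scl (counit circ (mul circ x y)) (bas ()) = scl (counit circ x) (scl (counit circ y) (bas ()))"
    proof (rule bilin_eqI[of "\<lambda>x y. scl (counit circ (mul circ x y)) (bas ())"
          "\<lambda>x y. scl (counit circ x) (scl (counit circ y) (bas ()))"])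
      show "bilin (\<lambda>x y. scl (counit circ (mul circ x y)) (bas ()))"
        by (intro bilinI lin_counit bilinD[OF bilin_circ])
      show "bilin (\<lambda>x y. scl (counit circ x) (scl (counit circ y) (bas ())))"
      proof (rule bilinI)
        show "lin (\<lambda>y. scl (counit circ x) (scl (counit circ y) (bas ())))" for x
          by (intro lin_scale lin_counit lin_id)
        show "lin (\<lambda>x. scl (counit circ x) (scl (counit circ y) (bas ())))" for y
          by (intro lin_counit lin_id)
      qed
    qed simp
    then show ?thesis by (auto dest!: arg_cong[of _ _ "\<lambda>x. Poly_Mapping.lookup x ()"])
  qed
  have c1: "linext (\<lambda>(i, j). scl (counit circ (bas i)) (bas j)) (comul circ h) = h"
    "linext (\<lambda>(i, j). scl (counit circ (bas j)) (bas i)) (comul circ h) = h" for h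
    by (rule lin_eqI[of "\<lambda>h. linext _ (comul circ h)" "\<lambda>h. h", OF lin_comp[OF lin_linext lin_circ(1)] lin_id(1)],
        simp)+
  have s: "linext (\<lambda>(i, j). mul circ (antipode circ (bas i)) (bas j)) (comul circ h) = scl (counit circ h) (unt circ)"
    "linext (\<lambda>(i, j). mul circ (bas i) (antipode circ (bas j))) (comul circ h) = scl (counit circ h) (unt circ)" for h
    by (rule lin_eqI[of "\<lambda>h. linext _ (comul circ h)" "\<lambda>h. scl (counit circ h) (unt circ)",
          OF lin_comp[OF lin_linext lin_circ(1)] lin_counit[OF lin_id(1)]],
        simp add: circ_unt)+
  show ?thesis
    unfolding is_hopf_def
    by (intro conjI allI hom coas counit_scl counit_add cm c1 s lin_circ circ_is_alg) (simp add: circ_unt)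
qed

lemma circ_frm_mul [simp]: "mul circ_frm (bas (m, f)) (bas (n, g)) = tens (bas (m + n)) (cgen_mul f g)"
  and bilin_circ_frm [simp]: "bilin (mul circ_frm)"
  and circ_frm_dif [simp]: "dif circ_frm (bas (m, f)) = (if f = C1 then scl (of_int m) (bas (m - 1, Ct)) else 0)"
  and lin_circ_frm [simp]: "lin (dif circ_frm)"
  and circ_frm_deg [simp]: "deg circ_frm (m, f) = (if f = C1 then 0 else 1)"
  and circ_frm_unt: "unt circ_frm = bas (0, C1)"
  by (simp_all add: circ_frm_def)

lemmas cf = bilin_simps[OF bilin_circ_frm]

lemma zero_hcomp [simp]: "0 \<in> hcomp W k" by (simp add: hcomp_def)

lemma circ_emb_bas [simp]: "circ_emb (bas n) = bas (n, C1)"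
  by (simp add: circ_emb_def fun_eq_iff)

lemma lin_circ_emb [simp]: "lin circ_emb"
  unfolding circ_emb_def[abs_def] by (rule bilinD[OF bilin_tens])

lemma circ_frm_calculus: "is_calculus circ circ_frm circ_emb"
proof (rule is_calculusI)
  have A: "is_alg circ_frm"
  proof (rule is_algI)
    fix i j k :: "int \<times> cgen"
    show "mul circ_frm (mul circ_frm (bas i) (bas j)) (bas k) = mul circ_frm (bas i) (mul circ_frm (bas j) (bas k))"
      by (cases i; cases j; cases k; cases "snd i"; cases "snd j"; cases "snd k")
        (simp_all add: tens_simps cf add.assoc)
    show "mul circ_frm (unt circ_frm) (bas i) = bas i" "mul circ_frm (bas i) (unt circ_frm) = bas i"
      by (cases i; cases "snd i"; simp add: circ_frm_unt)+
  qed simp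
  show "is_dga circ_frm"
  proof (rule is_dgaI[OF A])
    show "unt circ_frm \<in> hcomp circ_frm 0"
      using bas_hcomp[of "(0, C1)" circ_frm] by (simp add: circ_frm_unt)
    fix i j :: "int \<times> cgen"
    show "mul circ_frm (bas i) (bas j) \<in> hcomp circ_frm (deg circ_frm i + deg circ_frm j)"
      by (cases i; cases j; cases "snd i"; cases "snd j") (simp_all add: tens_simps, simp_all add: hcomp_def)
    show "dif circ_frm (bas i) \<in> hcomp circ_frm (Suc (deg circ_frm i))"
      by (cases i; cases "snd i") (simp_all add: scl_single, simp_all add: hcomp_def)
    show "dif circ_frm (dif circ_frm (bas i)) = 0"
      by (cases i; cases "snd i") (simp_all add: lin_scl[OF lin_circ_frm] lin_zero[OF lin_circ_frm])
    show "dif circ_frm (mul circ_frm (bas i) (bas j)) = mul circ_frm (dif circ_frm (bas i)) (bas j)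
      + scl ((-1) ^ deg circ_frm i) (mul circ_frm (bas i) (dif circ_frm (bas j)))"
      by (cases i; cases j; cases "snd i"; cases "snd j")
        (simp_all add: tens_simps cf lin_zero[OF lin_circ_frm] add.assoc add.commute diff_add_eq add_diff_eq flip: fvec.scale_left_distrib)
  qed simp
  show "circ_emb = (\<lambda>a. tens a (bas C1))" by (simp add: circ_emb_def fun_eq_iff)
  then show "alg_hom circ circ_frm circ_emb"
    by (intro alg_homI) (simp_all add: circ_unt circ_frm_unt)
  show "deg circ_frm (i, f) = 0 \<longleftrightarrow> f = C1" for i f by simp
  fix i :: "int \<times> cgen"
  obtain n f where i: "i = (n, f)" by (cases i)
  show "bas i \<in> {form circ_frm circ_emb a bs |a bs. length bs = deg circ_frm i}"
  proof (cases f)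
    case C1
    then have "bas i = form circ_frm circ_emb (bas n) []" by (simp add: form_def i)
    with C1 i show ?thesis by force
  next
    case Ct
    then have "bas i = form circ_frm circ_emb (bas n) [circ_t]" by (simp add: form_def i)
    with Ct i show ?thesis by force
  qed
qed

lemma circ_frm_relations:
  defines "t \<equiv> circ_emb circ_t" and "dt \<equiv> dif circ_frm (circ_emb circ_t)"
  shows "mul circ_frm dt t = mul circ_frm t dt"
    and "bij_betw (\<lambda>h. mul circ_frm (circ_emb h) dt) UNIV (hcomp circ_frm 1)"
    and "k > 1 \<Longrightarrow> hcomp circ_frm k = {0}"
proof -
  have g: "dt = bas (0, Ct)" unfolding assms by simp
  show "mul circ_frm dt t = mul circ_frm t dt" unfolding assms by simp
  have "mul circ_frm (circ_emb h) (bas (0, Ct)) = linext (\<lambda>i. bas (i, Ct)) h" for h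
  proof (rule lin_eqI[of "\<lambda>h. mul circ_frm (circ_emb h) (bas (0, Ct))"])
    show "lin (\<lambda>h. mul circ_frm (circ_emb h) (bas (0, Ct)))"
      by (rule bilin_compL[OF bilin_circ_frm lin_circ_emb])
  qed simp_all
  moreover have "hcomp circ_frm 1 = {x. Poly_Mapping.keys x \<subseteq> range (\<lambda>i. (i, Ct))}"
  proof -
    have "deg circ_frm i = 1 \<longleftrightarrow> i \<in> range (\<lambda>i. (i, Ct))" for i :: "int \<times> cgen"
      by (cases i; cases "snd i") auto
    then show ?thesis by (auto simp: hcomp_def)
  qed
  ultimately show "bij_betw (\<lambda>h. mul circ_frm (circ_emb h) dt) UNIV (hcomp circ_frm 1)"
    using bij_linext_bas[of "\<lambda>i :: int. (i, Ct)"] by (simp add: g inj_def)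
  have "Poly_Mapping.keys x = {}" if k: "k > 1" and x: "x \<in> hcomp circ_frm k" for x
  proof (rule ccontr)
    assume "Poly_Mapping.keys x \<noteq> {}"
    then obtain i where "i \<in> Poly_Mapping.keys x" by blast
    with x have "deg circ_frm i = k" by (simp add: hcomp_def)
    with k show False by (cases i) (auto split: if_splits)
  qed
  then show "hcomp circ_frm k = {0}" if "k > 1" using that by auto
qed

section \<open>The calculus on the torus\<close>

lemma tor_frm_mul_bas:
  "tor_frm_mul \<theta> (bas ((m, n), f)) (bas ((p, r), g))
    = scl (tgen_twist \<theta> f (p, r) * tq \<theta> powi (n * p)) (tens (bas (m + p, n + r)) (tgen_mul \<theta> f g))"
  by (simp add: tor_frm_mul_def bilin_simps[OF bilin_tor_alg] tens_simps)

lemma bilin_tor_frm_mul [simp]: "bilin (tor_frm_mul \<theta>)"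
  by (simp add: tor_frm_mul_def)

lemma tor_frm_sel: "mul (tor_frm \<theta>) = tor_frm_mul \<theta>" "unt (tor_frm \<theta>) = bas ((0, 0), T1)"
  "deg (tor_frm \<theta>) (a, f) = tgen_deg f"
  by (simp_all add: tor_frm_def)

lemma lin_tor_dif [simp]: "lin (dif (tor_frm \<theta>))" by (simp add: tor_frm_def)

lemma tor_frm_dif: "dif (tor_frm \<theta>) (bas ((m, n), f)) = tor_frm_mul \<theta>
        (scl (of_int m * tq \<theta> powi (- n)) (bas ((m - 1, n), Tu)) + scl (of_int n) (bas ((m, n - 1), Tv)))
        (bas ((0, 0), f))"
  by (simp add: tor_frm_def)

lemmas tf = bilin_simps[OF bilin_tor_frm_mul]
lemmas td = lin_add[OF lin_tor_dif] lin_scl[OF lin_tor_dif] lin_zero[OF lin_tor_dif]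

lemma tens_single: "tens (Poly_Mapping.single i c) (Poly_Mapping.single j d) = Poly_Mapping.single (i, j) (c * d)"
proof -
  have "tens (scl c (bas i)) (scl d (bas j)) = scl (c * d) (bas (i, j))" by (simp add: tens_simps)
  then show ?thesis by (simp add: scl_single)
qed

lemma tor_frm_mul_single:
  "tor_frm_mul \<theta> (Poly_Mapping.single ((m, n), f) c) (Poly_Mapping.single ((p, r), g) d)
    = scl (c * d * tgen_twist \<theta> f (p, r) * tq \<theta> powi (n * p)) (tens (bas (m + p, n + r)) (tgen_mul \<theta> f g))"
proof -
  have "tor_frm_mul \<theta> (scl c (bas ((m, n), f))) (scl d (bas ((p, r), g)))
    = scl (c * d * tgen_twist \<theta> f (p, r) * tq \<theta> powi (n * p)) (tens (bas (m + p, n + r)) (tgen_mul \<theta> f g))"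
    by (simp add: tf tor_frm_mul_bas mult_ac)
  then show ?thesis by (simp add: scl_single)
qed

lemma tor_dif_single:
  "dif (tor_frm \<theta>) (Poly_Mapping.single ((m, n), T1) c) =
     Poly_Mapping.single ((m - 1, n), Tu) (c * of_int m * tq \<theta> powi (- n))
     + Poly_Mapping.single ((m, n - 1), Tv) (c * of_int n)"
  "dif (tor_frm \<theta>) (Poly_Mapping.single ((m, n), Tu) c) = Poly_Mapping.single ((m, n - 1), Tuv) (- c * of_int n * tq \<theta>)"
  "dif (tor_frm \<theta>) (Poly_Mapping.single ((m, n), Tv) c) = Poly_Mapping.single ((m - 1, n), Tuv) (c * of_int m * tq \<theta> powi (- n))"
  "dif (tor_frm \<theta>) (Poly_Mapping.single ((m, n), Tuv) c) = 0"
proof -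
  have *: "dif (tor_frm \<theta>) (Poly_Mapping.single i c) = scl c (dif (tor_frm \<theta>) (bas i))" for i
    by (simp flip: td(2) add: scl_single)
  show "dif (tor_frm \<theta>) (Poly_Mapping.single ((m, n), T1) c) =
     Poly_Mapping.single ((m - 1, n), Tu) (c * of_int m * tq \<theta> powi (- n))
     + Poly_Mapping.single ((m, n - 1), Tv) (c * of_int n)"
    "dif (tor_frm \<theta>) (Poly_Mapping.single ((m, n), Tu) c) = Poly_Mapping.single ((m, n - 1), Tuv) (- c * of_int n * tq \<theta>)"
    "dif (tor_frm \<theta>) (Poly_Mapping.single ((m, n), Tv) c) = Poly_Mapping.single ((m - 1, n), Tuv) (c * of_int m * tq \<theta> powi (- n))"
    "dif (tor_frm \<theta>) (Poly_Mapping.single ((m, n), Tuv) c) = 0"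
    by (simp_all add: * tor_frm_dif tf tor_frm_mul_single tens_simps tens_single scl_single fvec.scale_right_distrib mult_ac
        del: fvec.scale_minus_left)
qed

lemmas tor_simps = tor_frm_mul_single tor_dif_single tf td tens_simps(5,6) tens_single scl_single fvec.scale_right_distrib

lemma tor_frm_dga: "is_dga (tor_frm \<theta>)"
proof -
  have A: "is_alg (tor_frm \<theta>)"
  proof (rule is_algI)
    fix i j k :: "(int \<times> int) \<times> tgen"
    obtain m n f p r g s t h where e: "i = ((m, n), f)" "j = ((p, r), g)" "k = ((s, t), h)"
      by (metis surj_pair)
    show "mul (tor_frm \<theta>) (mul (tor_frm \<theta>) (bas i) (bas j)) (bas k)
      = mul (tor_frm \<theta>) (bas i) (mul (tor_frm \<theta>) (bas j) (bas k))"
      unfolding e tor_frm_sel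
      by (cases f; cases g; cases h)
        (simp_all add: tor_simps power_int_add power_int_diff power_int_minus
          distrib_left distrib_right left_diff_distrib right_diff_distrib add.assoc del: fvec.scale_minus_left,
         (simp_all add: field_simps)?)
    show "mul (tor_frm \<theta>) (unt (tor_frm \<theta>)) (bas i) = bas i" "mul (tor_frm \<theta>) (bas i) (unt (tor_frm \<theta>)) = bas i"
      unfolding e tor_frm_sel by (cases f; simp add: tor_frm_mul_bas)+
  qed (simp add: tor_frm_sel)
  show ?thesis
  proof (rule is_dgaI[OF A])
    show "unt (tor_frm \<theta>) \<in> hcomp (tor_frm \<theta>) 0"
      using bas_hcomp[of "((0, 0), T1)" "tor_frm \<theta>"] by (simp add: tor_frm_sel)
    fix i j :: "(int \<times> int) \<times> tgen"
    obtain m n f p r g where e: "i = ((m, n), f)" "j = ((p, r), g)" by (metis surj_pair)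
    show "mul (tor_frm \<theta>) (bas i) (bas j) \<in> hcomp (tor_frm \<theta>) (deg (tor_frm \<theta>) i + deg (tor_frm \<theta>) j)"
      unfolding e tor_frm_sel
      by (cases f; cases g) (simp_all add: tor_simps del: fvec.scale_minus_left, simp_all add: hcomp_def tor_frm_sel)
    have d: "dif (tor_frm \<theta>) (bas i) \<in> hcomp (tor_frm \<theta>) (Suc (tgen_deg f))"
      unfolding e by (cases f; simp add: tor_simps)
        (auto simp: hcomp_def tor_frm_sel split: if_splits dest!: subsetD[OF Poly_Mapping.keys_add])
    then show "dif (tor_frm \<theta>) (bas i) \<in> hcomp (tor_frm \<theta>) (Suc (deg (tor_frm \<theta>) i))"
      by (simp add: e tor_frm_sel)
    show "dif (tor_frm \<theta>) (dif (tor_frm \<theta>) (bas i)) = 0"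
      unfolding e by (cases f) (simp_all add: tor_simps power_int_diff power_int_minus field_simps flip: single_add)
    show "dif (tor_frm \<theta>) (mul (tor_frm \<theta>) (bas i) (bas j)) = mul (tor_frm \<theta>) (dif (tor_frm \<theta>) (bas i)) (bas j)
      + scl ((-1) ^ deg (tor_frm \<theta>) i) (mul (tor_frm \<theta>) (bas i) (dif (tor_frm \<theta>) (bas j)))"
      unfolding e tor_frm_sel
      by (cases f; cases g)
        (simp_all add: tor_simps del: fvec.scale_minus_left,
         simp_all add: power_int_add power_int_diff power_int_minus
          distrib_left distrib_right left_diff_distrib right_diff_distrib add_ac diff_add_eq add_diff_eq flip: single_add,
         simp_all add: field_simps,
         simp_all add: single_add algebra_simps,
         rule arg_cong[where f = "Poly_Mapping.single _"], rule minus_diff_commute)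
  qed simp
qed


lemma tor_emb_bas [simp]: "tor_emb (bas a) = bas (a, T1)"
  by (simp add: tor_emb_def)

lemma lin_tor_emb [simp]: "lin tor_emb"
  unfolding tor_emb_def[abs_def] by (rule bilinD[OF bilin_tens])

lemma tor_frm_calculus: "is_calculus (tor_alg \<theta>) (tor_frm \<theta>) tor_emb"
proof (rule is_calculusI[OF tor_frm_dga])
  show "tor_emb = (\<lambda>a. tens a (bas T1))" by (simp add: tor_emb_def fun_eq_iff)
  show "alg_hom (tor_alg \<theta>) (tor_frm \<theta>) tor_emb"
  proof (rule alg_homI)
    show "tor_emb (unt (tor_alg \<theta>)) = unt (tor_frm \<theta>)" by (simp add: tor_alg_def tor_frm_sel)
    show "tor_emb (mul (tor_alg \<theta>) (bas i) (bas j)) = mul (tor_frm \<theta>) (tor_emb (bas i)) (tor_emb (bas j))" for i j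
      by (cases i; cases j) (simp add: tor_frm_sel tor_frm_mul_bas lin_scl[OF lin_tor_emb])
  qed (simp_all add: tor_frm_sel)
  show "deg (tor_frm \<theta>) (i, f) = 0 \<longleftrightarrow> f = T1" for i f
    by (cases f) (simp_all add: tor_frm_sel)
  fix i :: "(int \<times> int) \<times> tgen"
  obtain m n f where i: "i = ((m, n), f)" by (metis surj_pair)
  have "\<exists>a bs. bas i = form (tor_frm \<theta>) tor_emb a bs \<and> length bs = tgen_deg f"
  proof (cases f)
    case T1
    have "bas i = form (tor_frm \<theta>) tor_emb (bas (m, n)) []" by (simp add: form_def i T1)
    with T1 show ?thesis by fastforce
  next
    case Tu
    have "bas i = form (tor_frm \<theta>) tor_emb (bas (m, n)) [tor_u]"
      by (simp add: form_def i Tu tor_frm_sel tor_simps)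
    with Tu show ?thesis by fastforce
  next
    case Tv
    have "bas i = form (tor_frm \<theta>) tor_emb (bas (m, n)) [tor_v]"
      by (simp add: form_def i Tv tor_frm_sel tor_simps)
    with Tv show ?thesis by fastforce
  next
    case Tuv
    have "bas i = form (tor_frm \<theta>) tor_emb (bas (m, n)) [tor_u, tor_v]"
      by (simp add: form_def i Tuv tor_frm_sel tor_simps)
    with Tuv show ?thesis by fastforce
  qed
  then show "bas i \<in> {form (tor_frm \<theta>) tor_emb a bs |a bs. length bs = deg (tor_frm \<theta>) i}"
    by (auto simp: i tor_frm_sel)
qed

lemma tor_frm_relations:
  fixes \<theta> :: real
  defines "u \<equiv> tor_emb tor_u" and "v \<equiv> tor_emb tor_v" and "M \<equiv> mul (tor_frm \<theta>)"
    and "du \<equiv> dif (tor_frm \<theta>) (tor_emb tor_u)" and "dv \<equiv> dif (tor_frm \<theta>) (tor_emb tor_v)"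
  shows "M du u = M u du" "M dv v = M v dv"
    "M du v = scl (exp (- \<i> * of_real \<theta>)) (M v du)" "M dv u = scl (exp (\<i> * of_real \<theta>)) (M u dv)"
    "M du dv + scl (exp (- \<i> * of_real \<theta>)) (M dv du) = 0" "M du du = 0" "M dv dv = 0"
proof -
  have q: "exp (- \<i> * of_real \<theta>) = inverse (tq \<theta>)" "exp (\<i> * of_real \<theta>) = tq \<theta>"
    by (simp_all add: tq_def exp_minus)
  show "M du u = M u du" "M dv v = M v dv" "M du v = scl (exp (- \<i> * of_real \<theta>)) (M v du)"
    "M dv u = scl (exp (\<i> * of_real \<theta>)) (M u dv)"
    "M du dv + scl (exp (- \<i> * of_real \<theta>)) (M dv du) = 0" "M du du = 0" "M dv dv = 0"
    unfolding q assms
    by (simp_all add: tor_frm_sel tor_simps power_int_minus del: fvec.scale_minus_left flip: single_add)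
qed

lemma lookup_tens_bas:
  "Poly_Mapping.lookup (tens a (bas g)) (i, h) = (if h = g then Poly_Mapping.lookup a i else 0)"
proof -
  have "tens a (bas g) = (\<Sum>j\<in>Poly_Mapping.keys a. Poly_Mapping.single (j, g) (Poly_Mapping.lookup a j))"
    using fun_cong[OF lin_tens_bas[of g], of a] by (simp add: linext_def scl_single)
  then show ?thesis
    by (simp add: lookup_sum lookup_single when_def in_keys_iff sum.delta)
qed

lemma tor_frm_left:
  "mul (tor_frm \<theta>) (tor_emb a) (bas ((0, 0), f)) = tens a (bas f)"
proof (rule lin_eqI[of "\<lambda>a. mul (tor_frm \<theta>) (tor_emb a) (bas ((0, 0), f))" "\<lambda>a. tens a (bas f)"])
  show "lin (\<lambda>a. mul (tor_frm \<theta>) (tor_emb a) (bas ((0, 0), f)))"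
    unfolding tor_frm_sel by (rule bilin_compL[OF bilin_tor_frm_mul lin_tor_emb])
  show "lin (\<lambda>a. tens a (bas f))" by (rule bilinD[OF bilin_tens])
  show "mul (tor_frm \<theta>) (tor_emb (bas i)) (bas ((0, 0), f)) = tens (bas i) (bas f)" for i
    by (cases i) (simp add: tor_frm_sel tor_frm_mul_bas)
qed

lemma tor_frm_free:
  fixes \<theta> :: real
  defines "du \<equiv> dif (tor_frm \<theta>) (tor_emb tor_u)" and "dv \<equiv> dif (tor_frm \<theta>) (tor_emb tor_v)"
  shows "bij_betw (\<lambda>(a, b). mul (tor_frm \<theta>) (tor_emb a) du + mul (tor_frm \<theta>) (tor_emb b) dv)
      UNIV (hcomp (tor_frm \<theta>) 1)"
    and "bij_betw (\<lambda>a. mul (tor_frm \<theta>) (tor_emb a) (mul (tor_frm \<theta>) du dv)) UNIV (hcomp (tor_frm \<theta>) 2)"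
    and "k > 2 \<Longrightarrow> hcomp (tor_frm \<theta>) k = {0}"
proof -
  have g: "du = bas ((0, 0), Tu)" "dv = bas ((0, 0), Tv)" "mul (tor_frm \<theta>) du dv = bas ((0, 0), Tuv)"
    unfolding assms by (simp_all add: tor_simps tor_frm_sel)
  define p :: "tgen \<Rightarrow> ((int \<times> int) \<times> tgen) fvec \<Rightarrow> (int \<times> int) fvec"
    where "p f = linext (\<lambda>(a, h). if h = f then bas a else 0)" for f
  have lp: "lin (p f)" for f by (simp add: p_def)
  have p: "p f (tens a (bas h)) = (if h = f then a else 0)" for f a h
  proof (rule lin_eqI[of "\<lambda>a. p f (tens a (bas h))" "\<lambda>a. if h = f then a else 0"])
    show "lin (\<lambda>a. p f (tens a (bas h)))" by (rule lin_comp[OF lp bilinD(2)[OF bilin_tens]])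
    show "lin (\<lambda>a. if h = f then a else 0)" by (auto simp: lin_iff)
  qed (simp add: p_def)
  have t: "tens a (bas h) \<in> hcomp (tor_frm \<theta>) (tgen_deg h)" for a h
    by (auto simp: hcomp_def tor_frm_sel in_keys_iff lookup_tens_bas split: if_splits)
  have t': "tgen_deg f = Suc 0 \<longleftrightarrow> f = Tu \<or> f = Tv" "tgen_deg f = 2 \<longleftrightarrow> f = Tuv" for f
    by (cases f; simp)+
  show "bij_betw (\<lambda>(a, b). mul (tor_frm \<theta>) (tor_emb a) du + mul (tor_frm \<theta>) (tor_emb b) dv)
      UNIV (hcomp (tor_frm \<theta>) 1)"
    unfolding g(1,2) tor_frm_left
  proof (rule bij_betw_byWitness[where f' = "\<lambda>x. (p Tu x, p Tv x)"])
    have "tens (p Tu x) (bas Tu) + tens (p Tv x) (bas Tv) = x" if "x \<in> hcomp (tor_frm \<theta>) 1" for x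
      by (rule hcomp_eqI[of "\<lambda>x. tens (p Tu x) (bas Tu) + tens (p Tv x) (bas Tv)" "\<lambda>x. x", OF _ _ that])
        (intro lin_plus bilin_compL[OF bilin_tens] lp, rule lin_id, auto simp: t' tor_frm_sel p_def tens_simps)
    then show "\<forall>x\<in>hcomp (tor_frm \<theta>) 1. (case (p Tu x, p Tv x) of (a, b) \<Rightarrow> tens a (bas Tu) + tens b (bas Tv)) = x"
      by simp
    show "range (\<lambda>(a, b). tens a (bas Tu) + tens b (bas Tv)) \<subseteq> hcomp (tor_frm \<theta>) 1"
      using t[of _ Tu] t[of _ Tv] by (auto intro!: fvec.subspace_add[OF subspace_hcomp])
  qed (auto simp: p lin_add[OF lp])
  show "bij_betw (\<lambda>a. mul (tor_frm \<theta>) (tor_emb a) (mul (tor_frm \<theta>) du dv)) UNIV (hcomp (tor_frm \<theta>) 2)"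
    unfolding g(3) tor_frm_left
  proof (rule bij_betw_byWitness[where f' = "p Tuv"])
    have "tens (p Tuv x) (bas Tuv) = x" if "x \<in> hcomp (tor_frm \<theta>) 2" for x
      by (rule hcomp_eqI[of "\<lambda>x. tens (p Tuv x) (bas Tuv)" "\<lambda>x. x", OF _ _ that])
        (intro bilin_compL[OF bilin_tens] lp, rule lin_id, auto simp: t' tor_frm_sel p_def tens_simps)
    then show "\<forall>x\<in>hcomp (tor_frm \<theta>) 2. tens (p Tuv x) (bas Tuv) = x" by simp
    show "range (\<lambda>a. tens a (bas Tuv)) \<subseteq> hcomp (tor_frm \<theta>) 2"
      using t[of _ Tuv] by auto
  qed (auto simp: p)
  have "Poly_Mapping.keys x = {}" if k: "k > 2" and x: "x \<in> hcomp (tor_frm \<theta>) k" for x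
  proof (rule ccontr)
    assume "Poly_Mapping.keys x \<noteq> {}"
    then obtain i where i: "i \<in> Poly_Mapping.keys x" by blast
    obtain a f where "i = (a, f)" by (cases i)
    with i have "(a, f) \<in> Poly_Mapping.keys x" by simp
    with x have "tgen_deg f = k" by (auto simp: hcomp_def tor_frm_sel dest: bspec)
    with k show False by (cases f) auto
  qed
  then show "hcomp (tor_frm \<theta>) k = {0}" if "k > 2" using that by auto
qed

section \<open>The coaction on the torus\<close>

lemma tor_coact_unique:
  "\<exists>!\<delta>. alg_hom (tor_alg \<theta>) (alg_tens (tor_alg \<theta>) circ) \<delta>
    \<and> \<delta> tor_u = tens tor_u circ_t \<and> \<delta> tor_v = tens tor_v circ_t_inv"
  by (rule tor_alg_universal[where U' = "tens tor_u_inv circ_t_inv" and V' = "tens tor_v_inv circ_t"])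
    (simp_all add: is_alg_tens tor_alg_is_alg circ_is_alg alg_tens_bas tens_simps, simp_all add: alg_tens_def tor_alg_def circ_unt)

lemma tor_coact_eq: "tor_coact \<theta> = linext (\<lambda>(m, n). bas ((m, n), m - n))"
  unfolding tor_coact_def
proof (rule the1_equality[OF tor_coact_unique], intro conjI)
  show "alg_hom (tor_alg \<theta>) (alg_tens (tor_alg \<theta>) circ) (linext (\<lambda>(m, n). bas ((m, n), m - n)))"
  proof (rule alg_homI)
    fix i j :: "int \<times> int"
    show "linext (\<lambda>(m, n). bas ((m, n), m - n)) (mul (tor_alg \<theta>) (bas i) (bas j))
      = mul (alg_tens (tor_alg \<theta>) circ) (linext (\<lambda>(m, n). bas ((m, n), m - n)) (bas i)) (linext (\<lambda>(m, n). bas ((m, n), m - n)) (bas j))"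
      by (cases i; cases j) (simp add: alg_tens_bas tens_simps lin_scl[OF lin_linext] algebra_simps)
  qed (simp_all, simp add: alg_tens_def tor_alg_def circ_unt)
qed simp_all

lemma torus_is_cdata: "is_cdata (torus \<theta>)"
proof -
  have 1: "tmap id (comul circ) (tor_coact \<theta> a)
      = linext (\<lambda>((i, j), k). bas (i, (j, k))) (tmap (tor_coact \<theta>) id (tor_coact \<theta> a))" for a
    by (rule lin_eqI[of "\<lambda>a. tmap id (comul circ) (tor_coact \<theta> a)"
        "\<lambda>a. linext (\<lambda>((i, j), k). bas (i, (j, k))) (tmap (tor_coact \<theta>) id (tor_coact \<theta> a))"])
      (auto simp: tor_coact_eq intro!: lin_comp[OF lin_tmap] lin_comp[OF lin_linext])
  have 2: "linext (\<lambda>(i, j). scl (counit circ (bas j)) (bas i)) (tor_coact \<theta> a) = a" for a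
    by (rule lin_eqI[of "\<lambda>a. linext (\<lambda>(i, j). scl (counit circ (bas j)) (bas i)) (tor_coact \<theta> a)" "\<lambda>a. a"])
      (auto simp: tor_coact_eq intro!: lin_comp[OF lin_linext])
  have 3: "alg_hom (tor_alg \<theta>) (alg_tens (tor_alg \<theta>) circ) (tor_coact \<theta>)"
    unfolding tor_coact_def using theI'[OF tor_coact_unique[of \<theta>]] by blast
  show ?thesis
    unfolding is_cdata_def torus_def cdata.simps
    by (intro conjI allI 1 2 3 tor_alg_is_alg circ_is_hopf tor_frm_calculus circ_frm_calculus)
qed


end

theory Submission
  imports Defs
begin

text \<open>
  On generators \<open>\<Delta>(du) = du \<otimes> t + u \<otimes> dt\<close> and \<open>\<Delta>(dv) = dv \<otimes> t\<^sup>-\<^sup>1 - v \<otimes> t\<^sup>-\<^sup>2 dt\<close>, so the coaction on forms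
  is explicit on the basis \<open>u\<^sup>m v\<^sup>n \<omega>\<close>. Comparing the coefficients of \<open>t\<^sup>k dt\<close> shows that there is no
  horizontal 2-form, and that a 1-form is horizontal iff it is a left multiple of
  \<open>u\<^sup>-\<^sup>1 du + v\<^sup>-\<^sup>1 dv = (u v)\<^sup>-\<^sup>1 d(u v)\<close>, which commutes with \<open>u\<close> and \<open>v\<close> and is coinvariant. Hence the base
  forms are spanned by \<open>(u v)\<^sup>k\<close> and \<open>(u v)\<^sup>k (u v)\<^sup>-\<^sup>1 d(u v)\<close>. The coactions and the vertical projection of (iii)
  are determined by their values on \<open>u\<^sup>m v\<^sup>n du\<close> and \<open>u\<^sup>m v\<^sup>n dv\<close>.
\<close>

section \<open>Linear algebra\<close>

text \<open>A finite \<open>S\<close> chosen from \<open>j\<close> alone replaces the support of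
  \<open>x\<close>, so one formula gives the coefficient at \<open>j\<close> for every
  \<open>x\<close>. This is how coactions are read backwards later.\<close>

lemma lookup_linext:
  assumes "finite S" "\<And>i. i \<notin> S \<Longrightarrow> Poly_Mapping.lookup (f i) j = 0"
  shows "Poly_Mapping.lookup (linext f x) j
    = (\<Sum>i\<in>S. Poly_Mapping.lookup x i * Poly_Mapping.lookup (f i) j)"
proof -
  have "Poly_Mapping.lookup (linext f x) j
      = (\<Sum>i\<in>Poly_Mapping.keys x \<union> S. Poly_Mapping.lookup x i * Poly_Mapping.lookup (f i) j)"
    using assms(1) by (simp add: linext_sup[of "Poly_Mapping.keys x \<union> S"] lookup_sum)
  also have "\<dots> = (\<Sum>i\<in>S. Poly_Mapping.lookup x i * Poly_Mapping.lookup (f i) j)"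
    by (rule sum.mono_neutral_right) (use assms in auto)
  finally show ?thesis .
qed

lemma lin_subspaceI:
  assumes "lin f" "fvec.subspace V" "\<And>i. i \<in> Poly_Mapping.keys x \<Longrightarrow> f (bas i) \<in> V"
  shows "f x \<in> V"
  unfolding lin_expand[OF assms(1), of x] linext_def
  by (intro fvec.subspace_sum fvec.subspace_scale assms)

lemma lin_span_subspaceI:
  assumes f: "lin f" and V: "fvec.subspace V" and G: "\<And>y. y \<in> G \<Longrightarrow> f y \<in> V" and x: "x \<in> fvec.span G"
  shows "f x \<in> V"
  using x
proof (induction rule: fvec.span_induct_alt)
  case base
  show ?case by (simp add: lin_zero[OF f] fvec.subspace_0[OF V])
next
  case (step c y z)
  then show ?case by (simp add: lin_add[OF f] lin_scl[OF f] fvec.subspace_add[OF V] fvec.subspace_scale[OF V] G)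
qed

lemma lin_image_subspace: "lin f \<Longrightarrow> fvec.subspace V \<Longrightarrow> fvec.subspace (f ` V)"
  unfolding fvec.subspace_def by (auto simp flip: lin_add lin_scl) (metis imageI lin_zero)

lemma hcomp_disjoint: "k \<noteq> l \<Longrightarrow> hcomp W k \<inter> hcomp W l = {0}"
proof -
  assume "k \<noteq> l"
  then have "Poly_Mapping.keys x = {}" if "x \<in> hcomp W k" "x \<in> hcomp W l" for x
    using that unfolding hcomp_def by fastforce
  then show ?thesis by auto
qed

text \<open>Off \<^term>\<open>fvec.span G\<close> the map \<^term>\<open>f\<close> has to be cut off, because \<^const>\<open>the_lin\<close> vanishes there.\<close>

lemma the_lin_eq:
  assumes f: "lin f" and P: "P (\<lambda>x. if x \<in> fvec.span G then f x else 0)"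
    and u: "\<And>h y. lin_on (fvec.span G) h \<Longrightarrow> P h \<Longrightarrow> y \<in> G \<Longrightarrow> h y = f y"
  shows "the_lin (fvec.span G) P = (\<lambda>x. if x \<in> fvec.span G then f x else 0)"
  unfolding the_lin_def
proof (rule the_equality)
  let ?W = "fvec.span G"
  note s = fvec.subspace_add[OF fvec.subspace_span] fvec.subspace_scale[OF fvec.subspace_span]
  show "lin_on ?W (\<lambda>x. if x \<in> ?W then f x else 0) \<and>
      (\<forall>x. x \<notin> ?W \<longrightarrow> (if x \<in> ?W then f x else 0) = 0) \<and> P (\<lambda>x. if x \<in> ?W then f x else 0)"
    using P by (auto simp: lin_on_def lin_add[OF f] lin_scl[OF f] intro: s fvec.span_add fvec.span_scale)
  fix h assume h: "lin_on ?W h \<and> (\<forall>x. x \<notin> ?W \<longrightarrow> h x = 0) \<and> P h"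
  \<comment> \<open>Membership is carried through the induction because \<open>h\<close> is additive
    only on \<open>?W\<close>, and the step case needs it for the tail of the sum.\<close>
  have "h x = f x \<and> x \<in> ?W" if "x \<in> ?W" for x
    using that
  proof (induction rule: fvec.span_induct_alt)
    case base
    \<comment> \<open>Scaling by 0 yields \<open>h 0 = 0\<close>, which \<open>lin_on\<close> does
      not state.\<close>
    have "h (scl 0 0) = scl 0 (h 0)" using h fvec.span_zero[of G] unfolding lin_on_def by blast
    then show ?case by (simp add: lin_zero[OF f] fvec.span_zero)
  next
    case (step c y z)
    then have y: "y \<in> ?W" and z: "z \<in> ?W" by (auto intro: fvec.span_base)
    then have "h (scl c y + z) = scl c (h y) + h z"
      using h s unfolding lin_on_def by metis
    with step y z u[of h y] h show ?case by (simp add: lin_add[OF f] lin_scl[OF f] fvec.span_add fvec.span_scale)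
  qed
  then show "h = (\<lambda>x. if x \<in> ?W then f x else 0)" using h by auto
qed

section \<open>The tensor product of differential graded algebras\<close>

lemma dga_tens_sel:
  "mul (dga_tens W V) (bas (i, j)) (bas (k, l))
    = scl ((-1) ^ (deg V j * deg W k)) (tens (mul W (bas i) (bas k)) (mul V (bas j) (bas l)))"
  "unt (dga_tens W V) = tens (unt W) (unt V)"
  "deg (dga_tens W V) (i, j) = deg W i + deg V j"
  "dif (dga_tens W V) (bas (i, j)) = tens (dif W (bas i)) (bas j)
      + scl ((-1) ^ deg W i) (tens (bas i) (dif V (bas j)))"
  by (simp_all add: dga_tens_def)

lemma bilin_dga_tens [simp]: "bilin (mul (dga_tens W V))"
  and lin_dga_tens [simp]: "lin (dif (dga_tens W V))"
  by (simp_all add: dga_tens_def)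

section \<open>The coaction on forms\<close>

abbreviation TC :: "real \<Rightarrow> (((int \<times> int) \<times> tgen) \<times> int \<times> cgen) dga"
  where "TC \<theta> \<equiv> dga_tens (tor_frm \<theta>) circ_frm"

text \<open>The values are forced: u^m v^n \<otimes> t^(m-n) is multiplied by the images of du, dv
  and du \<and> dv. Moving u left past v^n gives \<open>tq \<theta> powi n\<close>, and moving v
  left past du gives \<open>inverse (tq \<theta>)\<close>. For \<open>Tuv\<close>, the last minus
  sign is the Koszul sign of dt passing dv, and the product of the two dt terms vanishes.\<close>

fun tor_coact_gen :: "real \<Rightarrow> (int \<times> int) \<times> tgen \<Rightarrow> (((int \<times> int) \<times> tgen) \<times> int \<times> cgen) fvec"
  where
    "tor_coact_gen \<theta> ((m, n), T1) = bas (((m, n), T1), (m - n, C1))"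
  | "tor_coact_gen \<theta> ((m, n), Tu) = bas (((m, n), Tu), (m - n + 1, C1))
      + Poly_Mapping.single (((m + 1, n), T1), (m - n, Ct)) (tq \<theta> powi n)"
  | "tor_coact_gen \<theta> ((m, n), Tv) = bas (((m, n), Tv), (m - n - 1, C1))
      + Poly_Mapping.single (((m, n + 1), T1), (m - n - 2, Ct)) (- 1)"
  | "tor_coact_gen \<theta> ((m, n), Tuv) = bas (((m, n), Tuv), (m - n, C1))
      + Poly_Mapping.single (((m, n + 1), Tu), (m - n - 1, Ct)) (- inverse (tq \<theta>))
      + Poly_Mapping.single (((m + 1, n), Tv), (m - n - 1, Ct)) (- (tq \<theta> powi n))"

definition tor_coact_frm :: "real \<Rightarrow> ((int \<times> int) \<times> tgen) fvec \<Rightarrow> (((int \<times> int) \<times> tgen) \<times> int \<times> cgen) fvec"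
  where "tor_coact_frm \<theta> = linext (tor_coact_gen \<theta>)"

text \<open>Coefficients stay arbitrary because \<open>scl_single\<close> turns scaled basis vectors
  into \<open>Poly_Mapping.single\<close>, the normal form of all intermediate terms.\<close>

lemma TC_mul_single:
  "mul (TC \<theta>) (Poly_Mapping.single (((m, n), f), (k, c)) x) (Poly_Mapping.single (((p, r), g), (l, d)) y)
    = scl (x * y * (-1) ^ ((if c = C1 then 0 else 1) * tgen_deg g) * tgen_twist \<theta> f (p, r) * tq \<theta> powi (n * p))
        (tens (tens (bas (m + p, n + r)) (tgen_mul \<theta> f g)) (tens (bas (k + l)) (cgen_mul c d)))"
proof -
  have "mul (TC \<theta>) (scl x (bas (((m, n), f), (k, c)))) (scl y (bas (((p, r), g), (l, d))))
    = scl (x * y * (-1) ^ ((if c = C1 then 0 else 1) * tgen_deg g) * tgen_twist \<theta> f (p, r) * tq \<theta> powi (n * p))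
        (tens (tens (bas (m + p, n + r)) (tgen_mul \<theta> f g)) (tens (bas (k + l)) (cgen_mul c d)))"
    by (simp add: bilin_simps[OF bilin_dga_tens] dga_tens_sel tor_frm_sel tor_frm_mul_bas tens_simps mult_ac
      del: fvec.scale_minus_left)
  then show ?thesis by (simp add: scl_single)
qed

lemma TC_dif_single:
  "dif (TC \<theta>) (Poly_Mapping.single (((m, n), f), (k, c)) x)
    = scl x (tens (dif (tor_frm \<theta>) (bas ((m, n), f))) (bas (k, c)))
      + (if c = C1 then Poly_Mapping.single (((m, n), f), (k - 1, Ct)) (x * (-1) ^ tgen_deg f * of_int k) else 0)"
proof -
  have "dif (TC \<theta>) (scl x (bas (((m, n), f), (k, c))))
    = scl x (tens (dif (tor_frm \<theta>) (bas ((m, n), f))) (bas (k, c)))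
      + (if c = C1 then scl (x * (-1) ^ tgen_deg f * of_int k) (bas (((m, n), f), (k - 1, Ct))) else 0)"
    by (simp add: lin_scl[OF lin_dga_tens] dga_tens_sel tor_frm_sel tens_simps fvec.scale_right_distrib mult_ac
      del: fvec.scale_minus_left)
  then show ?thesis by (simp add: scl_single)
qed

lemma tor_coact_frm_single:
  "tor_coact_frm \<theta> (Poly_Mapping.single i c) = scl c (tor_coact_gen \<theta> i)"
  using lin_scl[of "tor_coact_frm \<theta>" c "bas i"] by (simp add: tor_coact_frm_def scl_single)

lemmas TC_simps = TC_mul_single TC_dif_single tor_coact_frm_single bilin_simps[OF bilin_dga_tens]

lemma lin_tor_coact_frm [simp]: "lin (tor_coact_frm \<theta>)" by (simp add: tor_coact_frm_def)

lemma tor_coact_frm_bas [simp]: "tor_coact_frm \<theta> (bas i) = tor_coact_gen \<theta> i"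
  by (simp add: tor_coact_frm_def)

lemmas tor_coact_frm_lin = lin_zero[OF lin_tor_coact_frm] lin_add[OF lin_tor_coact_frm] lin_scl[OF lin_tor_coact_frm]

section \<open>Compatibility of the explicit coaction with product, differential and degree\<close>

lemma tor_coact_frm_mul:
  "tor_coact_frm \<theta> (mul (tor_frm \<theta>) (bas i) (bas j)) = mul (TC \<theta>) (tor_coact_gen \<theta> i) (tor_coact_gen \<theta> j)"
proof -
  obtain m n f p r g where e: "i = ((m, n), f)" "j = ((p, r), g)" by (metis surj_pair)
  show ?thesis
    unfolding e tor_frm_sel
    \<comment> \<open>Sixteen pairs of generators: powers of \<open>tq \<theta>\<close> are split,
      and the cases still open are compared coefficient by coefficient.\<close>
    by (cases f; cases g)
      (simp_all add: tor_simps TC_simps tor_coact_frm_lin tens_simps power_int_add power_int_diff power_int_minus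
         distrib_left distrib_right del: fvec.scale_minus_left,
       simp_all add: algebra_simps,
       (rule poly_mapping_eqI; simp add: lookup_add lookup_single when_def field_simps)+)
qed

lemma tor_coact_frm_dif:
  "tor_coact_frm \<theta> (dif (tor_frm \<theta>) (bas i)) = dif (TC \<theta>) (tor_coact_gen \<theta> i)"
proof -
  obtain m n f where e: "i = ((m, n), f)" by (metis surj_pair)
  show ?thesis
    unfolding e
    by (cases f)
      (simp_all add: tor_simps TC_simps tor_coact_frm_lin lin_add[OF lin_dga_tens] tens_simps
         power_int_add power_int_diff power_int_minus distrib_left distrib_right del: fvec.scale_minus_left,
       simp_all add: algebra_simps,
       (rule poly_mapping_eqI; simp add: lookup_add lookup_single when_def field_simps)+)
qed

lemma single_hcomp: "deg W i = k \<Longrightarrow> Poly_Mapping.single i c \<in> hcomp W k"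
  by (simp add: hcomp_def)

text \<open>Each dt on the right replaces one du or dv on the left, so the total degree is
  kept.\<close>

lemma tor_coact_gen_hcomp: "tor_coact_gen \<theta> i \<in> hcomp (TC \<theta>) (deg (tor_frm \<theta>) i)"
proof -
  obtain m n f where e: "i = ((m, n), f)" by (metis surj_pair)
  show ?thesis
    unfolding e
    by (cases f) (auto intro!: fvec.subspace_add[OF subspace_hcomp] single_hcomp simp: dga_tens_sel tor_frm_sel)
qed

lemma torus_sel [simp]: "calg (torus \<theta>) = tor_alg \<theta>" "chopf (torus \<theta>) = circ" "coact (torus \<theta>) = tor_coact \<theta>"
  "frm (torus \<theta>) = tor_frm \<theta>" "emb (torus \<theta>) = tor_emb" "hfrm (torus \<theta>) = circ_frm" "hemb (torus \<theta>) = circ_emb"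
  by (simp_all add: torus_def)

lemma lin_tor_coact [simp]: "lin (tor_coact \<theta>)"
  and tor_coact_bas [simp]: "tor_coact \<theta> (bas (m, n)) = bas ((m, n), m - n)"
  by (simp_all add: tor_coact_eq)

lemma tor_extends_coact: "extends_coact (torus \<theta>) (tor_coact_frm \<theta>)"
  unfolding extends_coact_def dga_hom_def torus_sel
proof (intro conjI allI ballI)
  show "alg_hom (tor_frm \<theta>) (TC \<theta>) (tor_coact_frm \<theta>)"
    by (rule alg_homI) (simp_all add: tor_coact_frm_mul dga_tens_sel circ_frm_unt, simp_all add: tor_frm_sel)
  show "tor_coact_frm \<theta> x \<in> hcomp (TC \<theta>) k" if "x \<in> hcomp (tor_frm \<theta>) k" for x k
    by (rule hcomp_image[OF lin_tor_coact_frm subspace_hcomp that]) (use tor_coact_gen_hcomp in fastforce)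
  show "tor_coact_frm \<theta> (dif (tor_frm \<theta>) x) = dif (TC \<theta>) (tor_coact_frm \<theta> x)" for x
    by (rule lin_eqI[of "\<lambda>x. tor_coact_frm \<theta> (dif (tor_frm \<theta>) x)"])
      (auto intro!: lin_comp[OF lin_tor_coact_frm] lin_comp[OF lin_dga_tens] simp: tor_coact_frm_dif)
  show "tor_coact_frm \<theta> (tor_emb a) = tmap tor_emb circ_emb (tor_coact \<theta> a)" for a
    by (rule lin_eqI[of "\<lambda>a. tor_coact_frm \<theta> (tor_emb a)"])
      (auto intro!: lin_comp[OF lin_tor_coact_frm] lin_comp[OF lin_tmap])
qed

text \<open>\<open>ext_coact\<close> is a definite description. The calculus is generated by its
  degree 0 part, so the extension is unique and every later computation may use the explicit
  map.\<close>

lemma tor_ext_coact: "ext_coact (torus \<theta>) = tor_coact_frm \<theta>"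
  by (rule ext_coact_eq[OF _ tor_extends_coact]) (simp add: tor_frm_calculus)

section \<open>Horizontal forms and base forms\<close>

text \<open>The exponent of t in the dt-free summand of the coaction: u and du have weight 1, v and
  dv have weight -1.\<close>

fun tor_weight :: "(int \<times> int) \<times> tgen \<Rightarrow> int"
  where "tor_weight ((m, n), Tu) = m - n + 1" | "tor_weight ((m, n), Tv) = m - n - 1" | "tor_weight ((m, n), _) = m - n"

text \<open>\<open>lookup_linext\<close> with its side condition split by generator, so that
  functions defined by pattern matching unfold.\<close>

lemma lookup_linext_tor:
  assumes "finite S"
    and "\<And>m n. ((m, n), T1) \<notin> S \<Longrightarrow> Poly_Mapping.lookup (f ((m, n), T1)) j = 0"
    and "\<And>m n. ((m, n), Tu) \<notin> S \<Longrightarrow> Poly_Mapping.lookup (f ((m, n), Tu)) j = 0"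
    and "\<And>m n. ((m, n), Tv) \<notin> S \<Longrightarrow> Poly_Mapping.lookup (f ((m, n), Tv)) j = 0"
    and "\<And>m n. ((m, n), Tuv) \<notin> S \<Longrightarrow> Poly_Mapping.lookup (f ((m, n), Tuv)) j = 0"
  shows "Poly_Mapping.lookup (linext f x) j
    = (\<Sum>i\<in>S. Poly_Mapping.lookup x i * Poly_Mapping.lookup (f i) j)"
proof (rule lookup_linext[OF assms(1)])
  fix i
  assume "i \<notin> S"
  moreover obtain m n g where "i = ((m, n), g)" by (metis surj_pair)
  ultimately show "Poly_Mapping.lookup (f i) j = 0" using assms(2-5) by (cases g) simp_all
qed

text \<open>Only the component at u^m v^n \<otimes> t^k dt receives two contributions, from u^(m-1)
  v^n du and u^m v^(n-1) dv, with the same exponent k = m - n - 1. Every other component comes from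
  at most one basis form.\<close>

lemma lookup_tor_coact_frm:
  "Poly_Mapping.lookup (tor_coact_frm \<theta> \<omega>) (i, (k, C1)) = (if k = tor_weight i then Poly_Mapping.lookup \<omega> i else 0)"
  "Poly_Mapping.lookup (tor_coact_frm \<theta> \<omega>) (((m, n), T1), (k, Ct)) = (if k = m - n - 1
     then tq \<theta> powi n * Poly_Mapping.lookup \<omega> ((m - 1, n), Tu) - Poly_Mapping.lookup \<omega> ((m, n - 1), Tv) else 0)"
  "Poly_Mapping.lookup (tor_coact_frm \<theta> \<omega>) (((m, n), Tu), (k, Ct)) = (if k = m - n
     then - inverse (tq \<theta>) * Poly_Mapping.lookup \<omega> ((m, n - 1), Tuv) else 0)"
  "Poly_Mapping.lookup (tor_coact_frm \<theta> \<omega>) (((m, n), Tv), (k, Ct)) = (if k = m - n - 2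
     then - (tq \<theta> powi n) * Poly_Mapping.lookup \<omega> ((m - 1, n), Tuv) else 0)"
  "Poly_Mapping.lookup (tor_coact_frm \<theta> \<omega>) (((m, n), Tuv), (k, Ct)) = 0"
proof -
  note l = lookup_linext_tor and d = lookup_add lookup_single when_def
  obtain m n f where i: "i = ((m, n), f)" by (metis surj_pair)
  show "Poly_Mapping.lookup (tor_coact_frm \<theta> \<omega>) (i, (k, C1)) = (if k = tor_weight i then Poly_Mapping.lookup \<omega> i else 0)"
    unfolding tor_coact_frm_def i by (cases f; subst l[of "{((m, n), f)}"]) (auto simp: d)
  show "Poly_Mapping.lookup (tor_coact_frm \<theta> \<omega>) (((m, n), T1), (k, Ct)) = (if k = m - n - 1
     then tq \<theta> powi n * Poly_Mapping.lookup \<omega> ((m - 1, n), Tu) - Poly_Mapping.lookup \<omega> ((m, n - 1), Tv) else 0)" for m n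
    unfolding tor_coact_frm_def by (subst l[of "{((m - 1, n), Tu), ((m, n - 1), Tv)}"]) (auto simp: d)
  show "Poly_Mapping.lookup (tor_coact_frm \<theta> \<omega>) (((m, n), Tu), (k, Ct)) = (if k = m - n
     then - inverse (tq \<theta>) * Poly_Mapping.lookup \<omega> ((m, n - 1), Tuv) else 0)" for m n
    unfolding tor_coact_frm_def by (subst l[of "{((m, n - 1), Tuv)}"]) (auto simp: d)
  show "Poly_Mapping.lookup (tor_coact_frm \<theta> \<omega>) (((m, n), Tv), (k, Ct)) = (if k = m - n - 2
     then - (tq \<theta> powi n) * Poly_Mapping.lookup \<omega> ((m - 1, n), Tuv) else 0)" for m n
    unfolding tor_coact_frm_def by (subst l[of "{((m - 1, n), Tuv)}"]) (auto simp: d)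
  show "Poly_Mapping.lookup (tor_coact_frm \<theta> \<omega>) (((m, n), Tuv), (k, Ct)) = 0" for m n
    unfolding tor_coact_frm_def by (subst l[of "{}"]) (auto simp: d)
qed

text \<open>The image of \<open>circ_emb\<close> is spanned by the \<open>bas (k, C1)\<close>, so
  membership is the vanishing of all dt coefficients.\<close>

lemma sub_tens_circ_emb:
  fixes z :: "('i \<times> int \<times> cgen) fvec"
  shows "z \<in> sub_tens UNIV (range circ_emb) \<longleftrightarrow> (\<forall>i k. Poly_Mapping.lookup z (i, (k, Ct)) = 0)" (is "_ \<longleftrightarrow> ?P z")
proof
  let ?G = "{tens x y |(x :: 'i fvec) y. x \<in> UNIV \<and> y \<in> range circ_emb}"
  have l: "lin (\<lambda>h. tens x (circ_emb h))" for x :: "'i fvec"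
    by (rule bilin_compR[OF bilin_tens lin_circ_emb])
  have s: "fvec.subspace (Collect ?P)"
    by (rule fvec.subspaceI) (simp_all add: lookup_add)
  have b: "?P (tens (bas i) (bas (k, C1)))" for i k
    by (simp add: lookup_single when_def)
  have "tens x (circ_emb h) \<in> Collect ?P" for x h
    by (rule lin_subspaceI[OF l s], rule lin_subspaceI[OF bilinD(2)[OF bilin_tens] s])
      (use b in simp)
  then have "?G \<subseteq> Collect ?P" by auto
  then show "?P z" if "z \<in> sub_tens UNIV (range circ_emb)"
    using fvec.span_minimal[OF _ s] that unfolding sub_tens_def by blast
  assume z: "?P z"
  show "z \<in> sub_tens UNIV (range circ_emb)"
    unfolding sub_tens_def
  proof (rule lin_subspaceI[OF lin_id(1) fvec.subspace_span])
    fix j assume j: "j \<in> Poly_Mapping.keys z"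
    obtain i k c where e: "j = (i, (k, c))" by (metis surj_pair)
    have "c = C1" using j z by (cases c) (auto simp: e in_keys_iff)
    then have "bas j = tens (bas i) (circ_emb (bas k))" by (simp add: e)
    then show "bas j \<in> fvec.span ?G" by (intro fvec.span_base) blast
  qed
qed

text \<open>Different basis 2-forms have different dt components, so nothing cancels in degree 2. In
  degree 1 the du and dv contributions must cancel, which is the second equation.\<close>

lemma hor_forms_iff:
  "\<omega> \<in> hor_forms (torus \<theta>) \<longleftrightarrow> (\<forall>m n. Poly_Mapping.lookup \<omega> ((m, n), Tuv) = 0 \<and>
    tq \<theta> powi n * Poly_Mapping.lookup \<omega> ((m - 1, n), Tu) = Poly_Mapping.lookup \<omega> ((m, n - 1), Tv))"
proof
  assume "\<omega> \<in> hor_forms (torus \<theta>)"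
  then have z: "Poly_Mapping.lookup (tor_coact_frm \<theta> \<omega>) (i, (k, Ct)) = 0" for i k
    by (simp add: hor_forms_def tor_ext_coact sub_tens_circ_emb del: split_paired_All)
  show "\<forall>m n. Poly_Mapping.lookup \<omega> ((m, n), Tuv) = 0 \<and>
    tq \<theta> powi n * Poly_Mapping.lookup \<omega> ((m - 1, n), Tu) = Poly_Mapping.lookup \<omega> ((m, n - 1), Tv)"
  proof (intro allI conjI)
    fix m n
    show "Poly_Mapping.lookup \<omega> ((m, n), Tuv) = 0"
      \<comment> \<open>This component is a nonzero multiple of the coefficient at
        \<open>((m, n), Tuv)\<close>.\<close>
      using z[of "((m, n + 1), Tu)" "m - n - 1"] by (simp add: lookup_tor_coact_frm)
    show "tq \<theta> powi n * Poly_Mapping.lookup \<omega> ((m - 1, n), Tu) = Poly_Mapping.lookup \<omega> ((m, n - 1), Tv)"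
      using z[of "((m, n), T1)" "m - n - 1"] by (simp add: lookup_tor_coact_frm)
  qed
next
  assume a: "\<forall>m n. Poly_Mapping.lookup \<omega> ((m, n), Tuv) = 0 \<and>
    tq \<theta> powi n * Poly_Mapping.lookup \<omega> ((m - 1, n), Tu) = Poly_Mapping.lookup \<omega> ((m, n - 1), Tv)"
  have "Poly_Mapping.lookup (tor_coact_frm \<theta> \<omega>) (i, (k, Ct)) = 0" for i k
    by (cases "(\<theta>, i)" rule: tor_coact_gen.cases) (simp_all add: lookup_tor_coact_frm a)
  then show "\<omega> \<in> hor_forms (torus \<theta>)"
    by (simp add: hor_forms_def tor_ext_coact sub_tens_circ_emb del: split_paired_All)
qed

lemma cgen_all: "(\<forall>c. P c) \<longleftrightarrow> P C1 \<and> P Ct"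
  by (metis cgen.exhaust)

text \<open>Comparison with \<omega> \<otimes> 1: the dt coefficients give horizontality, and the
  dt-free ones may occur only at t^0, which is weight 0.\<close>

lemma base_forms_iff:
  "\<omega> \<in> base_forms (torus \<theta>) \<longleftrightarrow> \<omega> \<in> hor_forms (torus \<theta>) \<and> (\<forall>i\<in>Poly_Mapping.keys \<omega>. tor_weight i = 0)"
proof -
  have "\<omega> \<in> base_forms (torus \<theta>) \<longleftrightarrow>
      (\<forall>i k c. Poly_Mapping.lookup (tor_coact_frm \<theta> \<omega>) (i, (k, c)) = Poly_Mapping.lookup (tens \<omega> (bas (0, C1))) (i, (k, c)))"
    by (auto simp: base_forms_def tor_ext_coact circ_frm_unt intro!: poly_mapping_eqI)
  also have "\<dots> \<longleftrightarrow> (\<forall>i k. Poly_Mapping.lookup (tor_coact_frm \<theta> \<omega>) (i, (k, Ct)) = 0) \<and>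
      (\<forall>i k. Poly_Mapping.lookup (tor_coact_frm \<theta> \<omega>) (i, (k, C1)) = (if k = 0 then Poly_Mapping.lookup \<omega> i else 0))"
    by (auto simp: lookup_tens_bas cgen_all)
  also have "\<dots> \<longleftrightarrow> \<omega> \<in> hor_forms (torus \<theta>) \<and> (\<forall>i\<in>Poly_Mapping.keys \<omega>. tor_weight i = 0)"
    unfolding hor_forms_def tor_ext_coact torus_sel mem_Collect_eq sub_tens_circ_emb lookup_tor_coact_frm(1) in_keys_iff Ball_def
    by metis
  finally show ?thesis .
qed

text \<open>\<open>u\<^sup>m v\<^sup>n (u\<^sup>-\<^sup>1 du + v\<^sup>-\<^sup>1 dv)\<close>\<close>

definition hform :: "real \<Rightarrow> int \<Rightarrow> int \<Rightarrow> ((int \<times> int) \<times> tgen) fvec"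
  where "hform \<theta> m n = Poly_Mapping.single ((m - 1, n), Tu) (tq \<theta> powi (- n)) + bas ((m, n - 1), Tv)"

lemma subspace_hor_forms: "fvec.subspace (hor_forms (torus \<theta>))"
  by (rule fvec.subspaceI) (auto simp: hor_forms_iff lookup_add distrib_left)

text \<open>Its linear extension projects onto the horizontal forms by keeping the functions and
  reading only the dv coefficients, which determine the du coefficients. The shift to
  \<open>n + 1\<close> makes the dv summand of the value equal to u^m v^n dv.\<close>

fun hor_gen :: "real \<Rightarrow> (int \<times> int) \<times> tgen \<Rightarrow> ((int \<times> int) \<times> tgen) fvec"
  where
    "hor_gen \<theta> (a, T1) = bas (a, T1)"
  | "hor_gen \<theta> ((m, n), Tv) = hform \<theta> m (n + 1)"
  | "hor_gen \<theta> _ = 0"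

lemma hor_gen_reproduces:
  assumes "\<omega> \<in> hor_forms (torus \<theta>)"
  shows "linext (hor_gen \<theta>) \<omega> = \<omega>"
proof (rule poly_mapping_eqI)
  fix i :: "(int \<times> int) \<times> tgen"
  obtain m n f where i: "i = ((m, n), f)" by (metis surj_pair)
  note l = lookup_linext_tor and d = hform_def lookup_add lookup_single when_def
  have h: "Poly_Mapping.lookup \<omega> ((m, n), Tuv) = 0"
    "tq \<theta> powi n * Poly_Mapping.lookup \<omega> ((m, n), Tu) = Poly_Mapping.lookup \<omega> ((m + 1, n - 1), Tv)" for m n
    using assms[unfolded hor_forms_iff, rule_format, of m n] assms[unfolded hor_forms_iff, rule_format, of "m + 1" n]
    by simp_all
  show "Poly_Mapping.lookup (linext (hor_gen \<theta>) \<omega>) i = Poly_Mapping.lookup \<omega> i"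
  proof (cases f)
    case T1
    show ?thesis unfolding i T1 by (subst l[of "{((m, n), T1)}"]) (auto simp: d)
  next
    case Tu
    \<comment> \<open>The du coefficient at \<open>(m, n)\<close> is produced by the dv coefficient
      at \<open>(m + 1, n - 1)\<close>; horizontality says that it is the right one.\<close>
    show ?thesis unfolding i Tu
      by (subst l[of "{((m + 1, n - 1), Tv)}"]) (auto simp: d power_int_minus simp flip: h(2))
  next
    case Tv
    show ?thesis unfolding i Tv by (subst l[of "{((m, n), Tv)}"]) (auto simp: d)
  next
    case Tuv
    show ?thesis unfolding i Tuv h(1) by (subst l[of "{}"]) (auto simp: d)
  qed
qed

lemma hform_hor: "hform \<theta> m n \<in> hor_forms (torus \<theta>)"
  by (auto simp: hor_forms_iff hform_def lookup_add lookup_single when_def power_int_minus)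

lemma eq_spanI:
  "fvec.subspace V \<Longrightarrow> G \<subseteq> V \<Longrightarrow> (\<And>x. x \<in> V \<Longrightarrow> x \<in> fvec.span G) \<Longrightarrow> V = fvec.span G"
  using fvec.span_minimal by blast

text \<open>A horizontal form is a combination of the \<open>hor_gen\<close> values on its own
  support, so conditions on the support, such as weight or degree, cut down the spanning
  family.\<close>

lemma hor_spanI:
  assumes "\<omega> \<in> hor_forms (torus \<theta>)" "\<And>i. i \<in> Poly_Mapping.keys \<omega> \<Longrightarrow> hor_gen \<theta> i \<in> fvec.span G"
  shows "\<omega> \<in> fvec.span G"
  using lin_subspaceI[OF lin_linext fvec.subspace_span, of \<omega> "hor_gen \<theta>" G] assms by (simp add: hor_gen_reproduces)

lemma hor_forms_eq:
  "hor_forms (torus \<theta>) = fvec.span (range (\<lambda>a. bas (a, T1)) \<union> range (\<lambda>(m, n). hform \<theta> m n))" (is "_ = fvec.span ?G")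
proof (rule eq_spanI[OF subspace_hor_forms])
  show "?G \<subseteq> hor_forms (torus \<theta>)"
    by (auto simp: hform_hor, auto simp: hor_forms_iff lookup_single)
  have "hor_gen \<theta> i \<in> fvec.span ?G" for i
    by (cases "(\<theta>, i)" rule: hor_gen.cases) (auto intro: fvec.span_base fvec.span_zero)
  then show "\<omega> \<in> fvec.span ?G" if "\<omega> \<in> hor_forms (torus \<theta>)" for \<omega>
    by (rule hor_spanI[OF that])
qed

section \<open>Spanning families of the base forms\<close>

lemma subspace_base_forms: "fvec.subspace (base_forms (torus \<theta>))"
proof -
  have "base_forms (torus \<theta>) = hor_forms (torus \<theta>) \<inter> {\<omega>. \<forall>i. tor_weight i \<noteq> 0 \<longrightarrow> Poly_Mapping.lookup \<omega> i = 0}"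
    unfolding base_forms_iff in_keys_iff set_eq_iff Int_iff mem_Collect_eq Ball_def by metis
  moreover have "fvec.subspace {\<omega>. \<forall>i. tor_weight i \<noteq> 0 \<longrightarrow> Poly_Mapping.lookup \<omega> i = 0}"
    by (rule fvec.subspaceI) (simp_all add: lookup_add)
  ultimately show ?thesis by (simp add: fvec.subspace_inter subspace_hor_forms)
qed

lemma hform_base: "hform \<theta> k k \<in> base_forms (torus \<theta>)"
  by (auto simp: base_forms_iff hform_hor, auto simp: hform_def in_keys_iff lookup_add lookup_single when_def split: if_splits)

text \<open>Weight 0 forces m = n on u^m v^n and m = n + 1 on u^m v^n dv, where
  \<open>hor_gen\<close> takes the value \<open>hform \<theta> m m\<close>.\<close>

lemma base_forms_eq:
  "base_forms (torus \<theta>) = fvec.span (range (\<lambda>k. bas ((k, k), T1)) \<union> range (\<lambda>k. hform \<theta> k k))" (is "_ = fvec.span ?G")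
proof (rule eq_spanI[OF subspace_base_forms])
  show "?G \<subseteq> base_forms (torus \<theta>)"
    by (auto simp: hform_base, auto simp: base_forms_iff hor_forms_iff lookup_single)
  have g: "hor_gen \<theta> i \<in> fvec.span ?G" if "tor_weight i = 0" for i
    using that by (cases "(\<theta>, i)" rule: hor_gen.cases) (auto simp: diff_eq_eq add.commute intro: fvec.span_base fvec.span_zero)
  show "\<omega> \<in> fvec.span ?G" if "\<omega> \<in> base_forms (torus \<theta>)" for \<omega>
    by (rule hor_spanI[of _ \<theta>, OF _ g]) (use that in \<open>simp_all add: base_forms_iff\<close>)
qed

lemma base_forms1_eq: "base_forms1 (torus \<theta>) = fvec.span (range (\<lambda>k. hform \<theta> k k))" (is "_ = fvec.span ?G")
proof (rule eq_spanI)
  show "fvec.subspace (base_forms1 (torus \<theta>))"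
    by (simp add: base_forms1_def fvec.subspace_inter subspace_base_forms subspace_hcomp)
  show "?G \<subseteq> base_forms1 (torus \<theta>)"
    by (auto simp: base_forms1_def hform_base,
      auto simp: hform_def tor_frm_sel intro!: fvec.subspace_add[OF subspace_hcomp] single_hcomp)
  have g: "hor_gen \<theta> i \<in> fvec.span ?G" if "tor_weight i = 0" "deg (tor_frm \<theta>) i = 1" for i
    using that by (cases "(\<theta>, i)" rule: hor_gen.cases) (auto simp: tor_frm_sel diff_eq_eq add.commute intro: fvec.span_base fvec.span_zero)
  show "\<omega> \<in> fvec.span ?G" if "\<omega> \<in> base_forms1 (torus \<theta>)" for \<omega>
    by (rule hor_spanI[of _ \<theta>, OF _ g]) (use that in \<open>simp_all add: base_forms1_def base_forms_iff hcomp_def\<close>)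
qed

section \<open>The pullback calculus\<close>

text \<open>The unit has degree 0 and differential 0, so \<omega> \<mapsto> \<omega> \<otimes> 1
  respects product and differential. Base forms are where this map agrees with the coaction, hence
  closed under both operations.\<close>

lemma TC_tens_unit:
  "mul (TC \<theta>) (tens x (bas (0, C1))) (tens y (bas (0, C1))) = tens (mul (tor_frm \<theta>) x y) (bas (0, C1))" (is ?m)
  "dif (TC \<theta>) (tens x (bas (0, C1))) = tens (dif (tor_frm \<theta>) x) (bas (0, C1))" (is ?d)
proof -
  have b: "bilin (mul (tor_frm \<theta>))" by (simp add: tor_frm_sel)
  note i = bilinI bilinD[OF bilin_tens] bilinD[OF b] bilin_compL[OF bilin_tens] bilin_compR[OF bilin_tens]
    bilin_compL[OF bilin_dga_tens] bilin_compR[OF bilin_dga_tens] lin_comp[OF lin_dga_tens] lin_tor_dif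
  show ?m
    by (rule bilin_eqI[of "\<lambda>x y. mul (TC \<theta>) (tens x (bas (0, C1))) (tens y (bas (0, C1)))"])
      (intro i, intro i, simp add: dga_tens_sel)
  show ?d
    by (rule lin_eqI[of "\<lambda>x. dif (TC \<theta>) (tens x (bas (0, C1)))"])
      (intro i, intro i, simp add: dga_tens_sel tens_simps)
qed

lemma base_forms_coact_iff: "\<omega> \<in> base_forms (torus \<theta>) \<longleftrightarrow> tor_coact_frm \<theta> \<omega> = tens \<omega> (bas (0, C1))"
  by (simp add: base_forms_def tor_ext_coact circ_frm_unt)

lemma base_forms_closed:
  assumes "\<omega> \<in> base_forms (torus \<theta>)"
  shows "\<omega>' \<in> base_forms (torus \<theta>) \<Longrightarrow> mul (tor_frm \<theta>) \<omega> \<omega>' \<in> base_forms (torus \<theta>)"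
    and "dif (tor_frm \<theta>) \<omega> \<in> base_forms (torus \<theta>)"
  using tor_extends_coact[of \<theta>] assms
  by (simp_all add: base_forms_coact_iff extends_coact_def dga_hom_def alg_hom_def TC_tens_unit)

lemma coinv_base_forms: "b \<in> coinv (torus \<theta>) \<Longrightarrow> tor_emb b \<in> base_forms (torus \<theta>)"
  using tor_extends_coact[of \<theta>]
  by (simp add: base_forms_coact_iff coinv_def extends_coact_def tmap_tens circ_unt)

lemma subspace_coinv: "fvec.subspace (coinv (torus \<theta>))"
  by (rule fvec.subspaceI) (simp_all add: coinv_def lin_zero[OF lin_tor_coact] lin_add[OF lin_tor_coact] lin_scl[OF lin_tor_coact] tens_simps)

lemma bas_coinv: "bas (k, k) \<in> coinv (torus \<theta>)"
  by (simp add: coinv_def circ_unt)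

lemma tor_emb_hcomp: "tor_emb a \<in> hcomp (tor_frm \<theta>) 0" "dif (tor_frm \<theta>) (tor_emb a) \<in> hcomp (tor_frm \<theta>) 1"
  "mul (tor_frm \<theta>) (tor_emb a) (dif (tor_frm \<theta>) (tor_emb b)) \<in> hcomp (tor_frm \<theta>) 1"
proof -
  have W: "is_dga (tor_frm \<theta>)" and r: "range tor_emb \<subseteq> hcomp (tor_frm \<theta>) 0"
    using tor_frm_calculus[of \<theta>] by (auto simp: is_calculus_def bij_betw_def)
  show "tor_emb a \<in> hcomp (tor_frm \<theta>) 0" using r by blast
  with W show "dif (tor_frm \<theta>) (tor_emb a) \<in> hcomp (tor_frm \<theta>) 1" unfolding is_dga_def One_nat_def by blast
  show "mul (tor_frm \<theta>) (tor_emb a) (dif (tor_frm \<theta>) (tor_emb b)) \<in> hcomp (tor_frm \<theta>) 1"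
    using form_hcomp[OF W r, of a "[b]"] by (simp add: form_def)
qed

text \<open>In u^(k-1) v^(k-1) d(u v) the dv term picks up \<open>tq \<theta> powi (k - 1)\<close>
  when v^(k-1) passes u; the scalar cancels it. It sits inside the differential so that the form is
  literally one product b db'.\<close>

lemma hform_eq_form:
  "hform \<theta> k k = mul (tor_frm \<theta>) (tor_emb (bas (k - 1, k - 1)))
      (dif (tor_frm \<theta>) (tor_emb (scl (tq \<theta> powi (1 - k)) (bas (1, 1)))))"
  by (simp add: hform_def tor_emb_def tor_frm_sel tor_simps power_int_diff power_int_minus field_simps)

lemma form_base_forms:
  "b \<in> coinv (torus \<theta>) \<Longrightarrow> set bs \<subseteq> coinv (torus \<theta>) \<Longrightarrow> form (tor_frm \<theta>) tor_emb b bs \<in> base_forms (torus \<theta>)"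
  by (induction bs rule: rev_induct) (simp_all add: form_def coinv_base_forms base_forms_closed)

text \<open>One inclusion is closure of the base forms under product and differential. For the
  other, the spanning family of \<open>base_forms_eq\<close> already consists of forms b and b
  db'.\<close>

lemma base_forms_pullback: "base_forms (torus \<theta>) = pullback_calculus (torus \<theta>) (coinv (torus \<theta>))"
  unfolding pullback_calculus_def torus_sel
proof (rule eq_spanI[OF subspace_base_forms])
  let ?B = "coinv (torus \<theta>)"
  let ?G = "{form (tor_frm \<theta>) tor_emb b bs |b bs. b \<in> ?B \<and> set bs \<subseteq> ?B}"
  show "?G \<subseteq> base_forms (torus \<theta>)" using form_base_forms by blast
  have "bas ((k, k), T1) = form (tor_frm \<theta>) tor_emb (bas (k, k)) []" for k by (simp add: form_def)
  moreover have "hform \<theta> k k = form (tor_frm \<theta>) tor_emb (bas (k - 1, k - 1)) [scl (tq \<theta> powi (1 - k)) (bas (1, 1))]" for k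
    by (simp add: form_def hform_eq_form)
  moreover have "set [] \<subseteq> ?B" "set [scl (tq \<theta> powi (1 - k)) (bas (1, 1))] \<subseteq> ?B" for k
    by (simp_all add: bas_coinv fvec.subspace_scale[OF subspace_coinv])
  ultimately have "range (\<lambda>k. bas ((k, k), T1)) \<union> range (\<lambda>k. hform \<theta> k k) \<subseteq> ?G"
    using bas_coinv[of _ \<theta>] by blast
  then show "\<omega> \<in> fvec.span ?G" if "\<omega> \<in> base_forms (torus \<theta>)" for \<omega>
    using that fvec.span_mono unfolding base_forms_eq by blast
qed

lemma base_forms1_span:
  "base_forms1 (torus \<theta>) = fvec.span {mul (tor_frm \<theta>) (tor_emb b) (dif (tor_frm \<theta>) (tor_emb b')) |b b'.
        b \<in> coinv (torus \<theta>) \<and> b' \<in> coinv (torus \<theta>)}" (is "_ = fvec.span ?G")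
proof (rule eq_spanI)
  show "fvec.subspace (base_forms1 (torus \<theta>))" by (simp add: base_forms1_eq)
  show "?G \<subseteq> base_forms1 (torus \<theta>)"
    by (auto simp: base_forms1_def base_forms_closed coinv_base_forms tor_emb_hcomp simp del: One_nat_def)
  have "range (\<lambda>k. hform \<theta> k k) \<subseteq> ?G"
    using hform_eq_form[of \<theta>] bas_coinv[of _ \<theta>] fvec.subspace_scale[OF subspace_coinv] by blast
  then show "\<omega> \<in> fvec.span ?G" if "\<omega> \<in> base_forms1 (torus \<theta>)" for \<omega>
    using that fvec.span_mono unfolding base_forms1_eq by blast
qed

lemma base_forms_dsum: "is_dsum (base_forms (torus \<theta>)) (emb (torus \<theta>) ` coinv (torus \<theta>)) (base_forms1 (torus \<theta>))"
  unfolding is_dsum_def torus_sel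
proof (intro conjI equalityI subsetI)
  let ?B = "coinv (torus \<theta>)"
  fix \<omega> assume "\<omega> \<in> base_forms (torus \<theta>)"
  then obtain x y where e: "\<omega> = x + y" and x: "x \<in> fvec.span (range (\<lambda>k. bas ((k, k), T1)))"
    and y: "y \<in> base_forms1 (torus \<theta>)"
    unfolding base_forms_eq fvec.span_Un base_forms1_eq by blast
  have "bas ((k, k), T1) \<in> tor_emb ` ?B" for k using bas_coinv[of k \<theta>] by (force intro!: image_eqI[of _ _ "bas (k, k)"])
  then have "x \<in> tor_emb ` ?B"
    using x fvec.span_minimal[OF _ lin_image_subspace[OF lin_tor_emb subspace_coinv], of "range (\<lambda>k. bas ((k, k), T1))"] by blast
  with e y show "\<omega> \<in> {x + y |x y. x \<in> tor_emb ` ?B \<and> y \<in> base_forms1 (torus \<theta>)}" by blast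
next
  show "\<omega> \<in> base_forms (torus \<theta>)" if "\<omega> \<in> {x + y |x y. x \<in> tor_emb ` coinv (torus \<theta>) \<and> y \<in> base_forms1 (torus \<theta>)}" for \<omega>
    using that by (auto simp: base_forms1_def intro!: fvec.subspace_add[OF subspace_base_forms] coinv_base_forms)
next
  \<comment> \<open>The two summands lie in degrees 0 and 1.\<close>
  show "\<omega> \<in> {0}" if "\<omega> \<in> tor_emb ` coinv (torus \<theta>) \<inter> base_forms1 (torus \<theta>)" for \<omega>
    using that hcomp_disjoint[of 0 1 "tor_frm \<theta>"] tor_emb_hcomp(1)[of _ \<theta>] by (auto simp: base_forms1_def)
  show "\<omega> \<in> tor_emb ` coinv (torus \<theta>) \<inter> base_forms1 (torus \<theta>)" if "\<omega> \<in> {0}" for \<omega>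
    using that fvec.subspace_0[OF lin_image_subspace[OF lin_tor_emb subspace_coinv], of \<theta>]
    by (simp add: base_forms1_eq fvec.span_zero)
qed

section \<open>Horizontal forms as the A-bimodule generated by the base forms\<close>

lemma hor_forms_span:
  "hor_forms (torus \<theta>) = fvec.span {mul (tor_frm \<theta>) (mul (tor_frm \<theta>) (tor_emb a) \<omega>) (tor_emb a') |a \<omega> a'.
        \<omega> \<in> base_forms (torus \<theta>)}" (is "_ = fvec.span ?G")
proof (rule eq_spanI[OF subspace_hor_forms])
  let ?M = "mul (tor_frm \<theta>)"
  have b: "bilin ?M" by (simp add: tor_frm_sel)
  have "?M (?M (tor_emb (bas (m, n))) (bas ((k, k), T1))) (tor_emb (bas (p, r)))
      = scl (tq \<theta> powi (n * k + (n + k) * p)) (bas ((m + k + p, n + k + r), T1))" for m n k p r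
    by (simp add: tor_frm_sel tor_simps power_int_add algebra_simps)
  \<comment> \<open>The scalar is the same as for functions because u^-1 du + v^-1 dv commutes with
    u and v.\<close>
  moreover have "?M (?M (tor_emb (bas (m, n))) (hform \<theta> k k)) (tor_emb (bas (p, r)))
      = scl (tq \<theta> powi (n * k + (n + k) * p)) (hform \<theta> (m + k + p) (n + k + r))" for m n k p r
    by (simp add: tor_frm_sel hform_def tor_simps power_int_add power_int_diff power_int_minus algebra_simps,
        simp add: divide_inverse mult_ac)
  ultimately have g: "?M (?M (tor_emb (bas a)) g) (tor_emb (bas a')) \<in> hor_forms (torus \<theta>)"
    if "g \<in> range (\<lambda>k. bas ((k, k), T1)) \<union> range (\<lambda>k. hform \<theta> k k)" for a a' g
    using that
    by (cases a; cases a') (auto simp: hform_hor intro!: fvec.subspace_scale[OF subspace_hor_forms],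
        auto simp: hor_forms_eq intro: fvec.span_base)
  have l: "lin (\<lambda>\<omega>. ?M (?M x \<omega>) y)" "lin (\<lambda>a. ?M (?M (tor_emb a) \<omega>) y)" "lin (\<lambda>a. ?M x (tor_emb a))" for x \<omega> y
    by (rule lin_comp[OF bilinD(2)[OF b] bilinD(1)[OF b]] lin_comp[OF bilinD(2)[OF b] bilin_compL[OF b lin_tor_emb]]
        bilin_compR[OF b lin_tor_emb])+
  \<comment> \<open>Linearity frees the arguments one at a time: first \<omega>, then the left
    factor, then the right one.\<close>
  have 1: "?M (?M (tor_emb (bas a)) \<omega>) (tor_emb (bas a')) \<in> hor_forms (torus \<theta>)" if "\<omega> \<in> base_forms (torus \<theta>)" for a a' \<omega>
    by (rule lin_span_subspaceI[OF l(1) subspace_hor_forms g that[unfolded base_forms_eq]])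
  have 2: "?M (?M (tor_emb a) \<omega>) (tor_emb (bas a')) \<in> hor_forms (torus \<theta>)" if "\<omega> \<in> base_forms (torus \<theta>)" for a a' \<omega>
    by (rule lin_subspaceI[OF l(2) subspace_hor_forms 1[OF that]])
  have "?M (?M (tor_emb a) \<omega>) (tor_emb a') \<in> hor_forms (torus \<theta>)" if "\<omega> \<in> base_forms (torus \<theta>)" for a a' \<omega>
    by (rule lin_subspaceI[OF l(3) subspace_hor_forms 2[OF that]])
  then show "?G \<subseteq> hor_forms (torus \<theta>)" by blast
  \<comment> \<open>For the converse, left multiples of the two base forms 1 and u^-1 du + v^-1 dv
    suffice.\<close>
  have e: "bas (a, T1) = ?M (?M (tor_emb (bas a)) (bas ((0, 0), T1))) (tor_emb (bas (0, 0)))"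
    "hform \<theta> m n = ?M (?M (tor_emb (bas (m, n))) (hform \<theta> 0 0)) (tor_emb (bas (0, 0)))" for a m n
    by (cases a, simp_all add: tor_frm_sel hform_def tor_simps power_int_minus)
  have "bas ((0, 0), T1) \<in> base_forms (torus \<theta>)"
    by (auto simp: base_forms_eq intro: fvec.span_base)
  then have "bas (a, T1) \<in> ?G" for a using e(1)[of a] by blast
  moreover have "hform \<theta> m n \<in> ?G" for m n using e(2)[of m n] hform_base[of \<theta> 0] by blast
  ultimately have "range (\<lambda>a. bas (a, T1)) \<union> range (\<lambda>(m, n). hform \<theta> m n) \<subseteq> ?G"
    by (intro Un_least image_subsetI, simp_all only: split_def)
  then show "\<omega> \<in> fvec.span ?G" if "\<omega> \<in> hor_forms (torus \<theta>)" for \<omega>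
    using that fvec.span_mono unfolding hor_forms_eq by blast
qed

section \<open>Vertical forms\<close>

lemma hcomp_span: "hcomp W k = fvec.span {bas i |i. deg W i = k}"
proof (rule eq_spanI[OF subspace_hcomp])
  show "x \<in> fvec.span {bas i |i. deg W i = k}" if "x \<in> hcomp W k" for x
    by (rule hcomp_image[OF lin_id(1) fvec.subspace_span that], rule fvec.span_base) blast
qed (auto simp: hcomp_def)

lemma span_range_bas: "fvec.span (range bas) = UNIV"
proof -
  have "x \<in> fvec.span (range bas)" for x :: "'i fvec"
    by (rule lin_subspaceI[OF lin_id(1) fvec.subspace_span], rule fvec.span_base) blast
  then show ?thesis by blast
qed

text \<open>The shift in the second value arises because dt itself has weight 1.\<close>

fun circ_coact_gen :: "int \<times> cgen \<Rightarrow> (int \<times> int \<times> cgen) fvec"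
  where "circ_coact_gen (n, C1) = bas (n, (n, C1))" | "circ_coact_gen (n, Ct) = bas (n + 1, (n, Ct))"

lemma torus_left_coact: "left_coact (torus \<theta>) = linext circ_coact_gen"
proof -
  let ?d = "\<lambda>g. dif circ_frm (circ_emb g)"
  let ?P = "\<lambda>L. (\<forall>h. L (circ_emb h) = tmap id circ_emb (comul circ h)) \<and>
    (\<forall>\<omega> g. L (mul circ_frm \<omega> (?d g)) = mul (alg_tens circ circ_frm) (L \<omega>) (tmap id (dif circ_frm \<circ> circ_emb) (comul circ g)))"
  note c = lin_comp[OF lin_linext] lin_comp[OF lin_tmap lin_circ(1)] lin_comp[OF lin_circ_frm lin_circ_emb]
  have P: "?P (linext circ_coact_gen)"
  proof (intro conjI allI)
    show "linext circ_coact_gen (circ_emb h) = tmap id circ_emb (comul circ h)" for h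
      by (rule lin_eqI[of "\<lambda>h. linext circ_coact_gen (circ_emb h)"]) (rule lin_comp[OF lin_linext lin_circ_emb], rule c(2), simp)
    show "linext circ_coact_gen (mul circ_frm \<omega> (?d g))
        = mul (alg_tens circ circ_frm) (linext circ_coact_gen \<omega>) (tmap id (dif circ_frm \<circ> circ_emb) (comul circ g))" for \<omega> g
    proof (rule bilin_eqI[of "\<lambda>\<omega> g. linext circ_coact_gen (mul circ_frm \<omega> (?d g))"
        "\<lambda>\<omega> g. mul (alg_tens circ circ_frm) (linext circ_coact_gen \<omega>) (tmap id (dif circ_frm \<circ> circ_emb) (comul circ g))"])
      show "bilin (\<lambda>\<omega> g. linext circ_coact_gen (mul circ_frm \<omega> (?d g)))"
        by (intro bilinI c(1) bilin_compR[OF bilin_circ_frm] bilinD[OF bilin_circ_frm] c(3))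
      show "bilin (\<lambda>\<omega> g. mul (alg_tens circ circ_frm) (linext circ_coact_gen \<omega>) (tmap id (dif circ_frm \<circ> circ_emb) (comul circ g)))"
        by (intro bilinI bilin_compR[OF bilin_alg_tens] bilin_compL[OF bilin_alg_tens] lin_linext c(2))
      show "linext circ_coact_gen (mul circ_frm (bas i) (?d (bas j)))
        = mul (alg_tens circ circ_frm) (linext circ_coact_gen (bas i)) (tmap id (dif circ_frm \<circ> circ_emb) (comul circ (bas j)))" for i j
        by (cases i rule: circ_coact_gen.cases)
          (simp_all add: cf tens_simps bilin_simps[OF bilin_alg_tens] alg_tens_bas lin_scl[OF lin_linext] lin_zero[OF lin_linext] algebra_simps)
    qed
  qed
  \<comment> \<open>The whole space is written as the span of its basis to fit
    \<open>the_lin_eq\<close>.\<close>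
  have "the_lin (fvec.span (range bas)) ?P = (\<lambda>x. if x \<in> fvec.span (range bas) then linext circ_coact_gen x else 0)"
  proof (rule the_lin_eq[OF lin_linext])
    show "?P (\<lambda>x. if x \<in> fvec.span (range bas) then linext circ_coact_gen x else 0)"
      using P by (simp add: span_range_bas)
    fix h y assume h: "?P h" and y: "y \<in> range (bas :: int \<times> cgen \<Rightarrow> _)"
    obtain n c where y: "y = bas (n, c)" using y by auto
    have 1: "h (circ_emb x) = tmap id circ_emb (comul circ x)"
      and 2: "h (mul circ_frm \<omega> (?d g)) = mul (alg_tens circ circ_frm) (h \<omega>) (tmap id (dif circ_frm \<circ> circ_emb) (comul circ g))" for x \<omega> g
      using h by blast+
    \<comment> \<open>The first clause at t^n and the second at \<omega> = t^n, g = t fix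
      \<open>h\<close> on t^n and on t^n dt.\<close>
    show "h y = linext circ_coact_gen y"
      using 1[of "bas n"] 2[of "bas (n, C1)" "bas 1"]
      by (cases c) (simp_all add: y alg_tens_bas)
  qed
  then show ?thesis by (simp add: left_coact_def span_range_bas)
qed

text \<open>Coinvariance is left weight 0. Since t^n has weight n and t^n dt has weight n + 1, only
  1 and t^-1 dt survive.\<close>

lemma coinv_forms_iff:
  "\<eta> \<in> coinv_forms (torus \<theta>) \<longleftrightarrow> (\<forall>i\<in>Poly_Mapping.keys \<eta>. i = (0, C1) \<or> i = (-1, Ct))"
proof -
  have l: "Poly_Mapping.lookup (linext f \<eta>) j = (\<Sum>i\<in>S. Poly_Mapping.lookup \<eta> i * Poly_Mapping.lookup (f i) j)"
    if "finite S" "\<And>n. (n, C1) \<notin> S \<Longrightarrow> Poly_Mapping.lookup (f (n, C1)) j = 0"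
      "\<And>n. (n, Ct) \<notin> S \<Longrightarrow> Poly_Mapping.lookup (f (n, Ct)) j = 0" for S and f :: "int \<times> cgen \<Rightarrow> (int \<times> int \<times> cgen) fvec" and j
  proof (rule lookup_linext[OF that(1)])
    show "Poly_Mapping.lookup (f i) j = 0" if "i \<notin> S" for i
      using that \<open>\<And>n. (n, C1) \<notin> S \<Longrightarrow> _\<close> \<open>\<And>n. (n, Ct) \<notin> S \<Longrightarrow> _\<close> by (cases i rule: circ_coact_gen.cases) simp_all
  qed
  have 1: "Poly_Mapping.lookup (linext circ_coact_gen \<eta>) (k, (n, C1)) = (if k = n then Poly_Mapping.lookup \<eta> (n, C1) else 0)" for k n
    by (subst l[of "{(n, C1)}"]) (auto simp: lookup_single when_def)
  have 2: "Poly_Mapping.lookup (linext circ_coact_gen \<eta>) (k, (n, Ct)) = (if k = n + 1 then Poly_Mapping.lookup \<eta> (n, Ct) else 0)" for k n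
    by (subst l[of "{(n, Ct)}"]) (auto simp: lookup_single when_def)
  have t: "Poly_Mapping.lookup (tens (bas 0) \<eta>) (k, i) = (if k = 0 then Poly_Mapping.lookup \<eta> i else 0)" for k :: int and i
  proof -
    have "tens (bas 0) \<eta> = linext (\<lambda>i. bas (0 :: int, i)) \<eta>"
      by (rule lin_eqI[of "tens (bas 0)"]) (simp_all add: bilinD)
    then show ?thesis
      by (subst \<open>tens (bas 0) \<eta> = _\<close>, subst lookup_linext[of "{i}"]) (auto simp: lookup_single when_def)
  qed
  \<comment> \<open>Two functions of \<open>k\<close> with value \<open>x\<close> at one point,
    \<open>p\<close> or 0, and zero elsewhere.\<close>
  have e: "(\<forall>k. (if k = p then x else 0) = (if k = 0 then x else 0)) \<longleftrightarrow> (x \<noteq> 0 \<longrightarrow> p = 0)" for p :: int and x :: complex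
    by (auto split: if_splits)
  have "\<eta> \<in> coinv_forms (torus \<theta>) \<longleftrightarrow>
    (\<forall>n c k. Poly_Mapping.lookup (linext circ_coact_gen \<eta>) (k, (n, c)) = Poly_Mapping.lookup (tens (bas 0) \<eta>) (k, (n, c)))"
    by (auto simp: coinv_forms_def torus_left_coact circ_unt intro!: poly_mapping_eqI)
  also have "\<dots> \<longleftrightarrow> (\<forall>n. (Poly_Mapping.lookup \<eta> (n, C1) \<noteq> 0 \<longrightarrow> n = 0) \<and> (Poly_Mapping.lookup \<eta> (n, Ct) \<noteq> 0 \<longrightarrow> n + 1 = 0))"
    unfolding cgen_all 1 2 t e ..
  also have "\<dots> \<longleftrightarrow> (\<forall>i\<in>Poly_Mapping.keys \<eta>. i = (0, C1) \<or> i = (-1, Ct))"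
    unfolding in_keys_iff Ball_def split_paired_All cgen_all by auto
  finally show ?thesis .
qed

lemma dt_over_t_eq: "dt_over_t = bas (-1, Ct)"
  by (simp add: dt_over_t_def cf)

lemma subspace_coinv_forms: "fvec.subspace (coinv_forms (torus \<theta>))"
proof -
  have "coinv_forms (torus \<theta>) = {\<eta>. \<forall>i. i \<noteq> (0, C1) \<and> i \<noteq> (-1, Ct) \<longrightarrow> Poly_Mapping.lookup \<eta> i = 0}"
    unfolding coinv_forms_iff in_keys_iff set_eq_iff mem_Collect_eq Ball_def by blast
  moreover have "fvec.subspace {\<eta>. \<forall>i. i \<noteq> (0, C1) \<and> i \<noteq> (-1 :: int, Ct) \<longrightarrow> Poly_Mapping.lookup \<eta> i = 0}"
    by (rule fvec.subspaceI) (simp_all add: lookup_add)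
  ultimately show ?thesis by simp
qed

lemma coinv_forms1_eq: "coinv_forms1 (torus \<theta>) = fvec.span {dt_over_t}"
proof (rule eq_spanI)
  show "fvec.subspace (coinv_forms1 (torus \<theta>))"
    by (simp add: coinv_forms1_def fvec.subspace_inter subspace_coinv_forms subspace_hcomp)
  show "{dt_over_t} \<subseteq> coinv_forms1 (torus \<theta>)"
    by (simp add: coinv_forms1_def coinv_forms_iff dt_over_t_eq hcomp_def)
  show "\<eta> \<in> fvec.span {dt_over_t}" if "\<eta> \<in> coinv_forms1 (torus \<theta>)" for \<eta>
    by (rule lin_subspaceI[OF lin_id(1) fvec.subspace_span], rule fvec.span_base)
      (use that in \<open>auto simp: coinv_forms1_def coinv_forms_iff dt_over_t_eq hcomp_def dest!: bspec split: if_splits\<close>)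
qed

lemma coinv_forms_eq: "coinv_forms (torus \<theta>) = {x + y |x y. x \<in> fvec.span {unt circ_frm} \<and> y \<in> coinv_forms1 (torus \<theta>)}"
proof -
  have "coinv_forms (torus \<theta>) = fvec.span ({unt circ_frm} \<union> {dt_over_t})"
  proof (rule eq_spanI[OF subspace_coinv_forms])
    show "{unt circ_frm} \<union> {dt_over_t} \<subseteq> coinv_forms (torus \<theta>)"
      by (simp add: coinv_forms_iff dt_over_t_eq circ_frm_unt)
    show "\<eta> \<in> fvec.span ({unt circ_frm} \<union> {dt_over_t})" if "\<eta> \<in> coinv_forms (torus \<theta>)" for \<eta>
      by (rule lin_subspaceI[OF lin_id(1) fvec.subspace_span], rule fvec.span_base)
        (use that in \<open>auto simp: coinv_forms_iff dt_over_t_eq circ_frm_unt\<close>)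
  qed
  then show ?thesis unfolding fvec.span_Un coinv_forms1_eq by blast
qed

lemma coinv_forms_dsum: "is_dsum (coinv_forms (torus \<theta>)) (fvec.span {unt circ_frm}) (coinv_forms1 (torus \<theta>))"
proof -
  have "fvec.span {unt circ_frm} \<subseteq> hcomp circ_frm 0"
    by (rule fvec.span_minimal[OF _ subspace_hcomp]) (simp add: circ_frm_unt hcomp_def)
  then have "fvec.span {unt circ_frm} \<inter> coinv_forms1 (torus \<theta>) = {0}"
    using hcomp_disjoint[of 0 1 circ_frm] fvec.span_zero[of "{unt circ_frm}"] fvec.span_zero[of "{dt_over_t}"]
    by (auto simp flip: coinv_forms1_eq[of \<theta>]) (auto simp: coinv_forms1_def)
  then show ?thesis by (simp add: is_dsum_def coinv_forms_eq)
qed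

section \<open>The connection form\<close>

lemma torus_sdif: "sdif (torus \<theta>) (bas m) (bas n) = scl (of_int n) (bas (n - m - 1, Ct))"
  by (simp add: sdif_def cf algebra_simps)

section \<open>One-forms on the torus and the maps prescribed on products a da'\<close>

lemma tor_degree1_cases:
  assumes "y \<in> {bas i |i. deg (tor_frm \<theta>) i = 1}"
  obtains m n where "y = bas ((m, n), Tu)" | m n where "y = bas ((m, n), Tv)"
proof -
  obtain m n f where y: "y = bas ((m, n), f)" and "deg (tor_frm \<theta>) ((m, n), f) = 1" using assms by auto
  then show thesis using that by (cases f) (simp_all add: tor_frm_sel)
qed

lemma tor_degree1_gen:
  "bas ((m, n), Tu) = mul (tor_frm \<theta>) (tor_emb (bas (m, n))) (dif (tor_frm \<theta>) (tor_emb tor_u))"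
  "bas ((m, n), Tv) = mul (tor_frm \<theta>) (tor_emb (bas (m, n))) (dif (tor_frm \<theta>) (tor_emb tor_v))"
  by (simp_all add: tor_frm_sel tor_simps)

text \<open>The exponents record v^n passing u^(p-1) or u^p, and du passing v^r.\<close>

lemma tor_form1:
  "mul (tor_frm \<theta>) (tor_emb (bas (m, n))) (dif (tor_frm \<theta>) (tor_emb (bas (p, r))))
    = scl (of_int p * tq \<theta> powi (n * (p - 1) - r)) (bas ((m + p - 1, n + r), Tu))
      + scl (of_int r * tq \<theta> powi (n * p)) (bas ((m + p, n + r - 1), Tv))"
  by (simp add: tor_frm_sel tor_simps power_int_add power_int_diff power_int_minus field_simps)

lemma bilin_tor_form1: "bilin (\<lambda>a b. mul (tor_frm \<theta>) (tor_emb a) (dif (tor_frm \<theta>) (tor_emb b)))"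
proof -
  have b: "bilin (mul (tor_frm \<theta>))" by (simp add: tor_frm_sel)
  show ?thesis
    by (intro bilinI bilin_compL[OF b] bilin_compR[OF b] lin_comp[OF lin_tor_dif] lin_tor_emb)
qed

text \<open>On 1-forms the coaction is the grading by \<open>tor_weight\<close>: both terms of
  \<open>tor_form1\<close> have weight \<open>m - n + p - r\<close>, the exponent of t in the
  product of the two coactions.\<close>

lemma torus_right_coact1:
  assumes "\<omega> \<in> hcomp (tor_frm \<theta>) 1"
  shows "right_coact1 (torus \<theta>) \<omega> = linext (\<lambda>i. bas (i, tor_weight i)) \<omega>"
proof -
  let ?F = "linext (\<lambda>i. bas (i, tor_weight i))" and ?G = "{bas i |i. deg (tor_frm \<theta>) i = 1}"
  let ?form = "\<lambda>a b. mul (tor_frm \<theta>) (tor_emb a) (dif (tor_frm \<theta>) (tor_emb b))"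
  let ?rhs = "\<lambda>a b. mul (alg_tens (tor_frm \<theta>) circ) (tmap tor_emb id (tor_coact \<theta> a))
     (tmap (dif (tor_frm \<theta>) \<circ> tor_emb) id (tor_coact \<theta> b))"
  let ?P = "\<lambda>R. \<forall>a b. R (?form a b) = ?rhs a b"
  have b: "?rhs (bas (m, n)) (bas (p, r)) = scl (of_int p * tq \<theta> powi (n * (p - 1) - r)) (bas (((m + p - 1, n + r), Tu), m - n + p - r))
      + scl (of_int r * tq \<theta> powi (n * p)) (bas (((m + p, n + r - 1), Tv), m - n + p - r))" for m n p r
  proof -
    have "tmap tor_emb id (tor_coact \<theta> (bas (m, n))) = tens (tor_emb (bas (m, n))) (bas (m - n))"
      "tmap (dif (tor_frm \<theta>) \<circ> tor_emb) id (tor_coact \<theta> (bas (p, r))) = tens (dif (tor_frm \<theta>) (tor_emb (bas (p, r)))) (bas (p - r))"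
      by simp_all
    moreover have "bilin (mul (tor_frm \<theta>))" by (simp add: tor_frm_sel)
    ultimately show ?thesis
      by (simp only: alg_tens_mul[OF _ bilin_circ] tor_form1 circ_mul tens_simps tens_bas) (simp add: algebra_simps)
  qed
  have P: "?F (?form a b) = ?rhs a b" for a b
  proof (rule bilin_eqI[of "\<lambda>a b. ?F (?form a b)" ?rhs])
    show "bilin (\<lambda>a b. ?F (?form a b))"
      by (intro bilinI lin_comp[OF lin_linext] bilinD[OF bilin_tor_form1])
    show "bilin ?rhs"
      by (intro bilinI bilin_compL[OF bilin_alg_tens] bilin_compR[OF bilin_alg_tens] lin_comp[OF lin_tmap] lin_tor_coact)
    show "?F (?form (bas i) (bas j)) = ?rhs (bas i) (bas j)" for i j
      by (cases i; cases j) (simp only: b tor_form1 lin_add[OF lin_linext] lin_scl[OF lin_linext] linext_bas, simp add: algebra_simps)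
  qed
  have "the_lin (fvec.span ?G) ?P = (\<lambda>x. if x \<in> fvec.span ?G then ?F x else 0)"
  proof (rule the_lin_eq[OF lin_linext])
    show "?P (\<lambda>x. if x \<in> fvec.span ?G then ?F x else 0)"
      using P tor_emb_hcomp(3) unfolding hcomp_span[symmetric] by simp
    \<comment> \<open>Each basis 1-form is itself a product a da', so the prescription determines
      \<open>h\<close> on it.\<close>
    show "h y = ?F y" if "?P h" "y \<in> ?G" for h y
      using that(2)
      by (cases rule: tor_degree1_cases) (use that(1) P in \<open>simp_all only: tor_degree1_gen[of _ _ \<theta>]\<close>)
  qed
  then show ?thesis using assms unfolding hcomp_span[symmetric] by (simp add: right_coact1_def)
qed

text \<open>The factor \<open>tq \<theta> powi n\<close> comes from v^n passing u, and the sign for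
  dv from S(t^-1) d(t^-1) = - t^-1 dt. The value 0 is a default outside degree 1.\<close>

fun pi_ver_gen :: "real \<Rightarrow> (int \<times> int) \<times> tgen \<Rightarrow> ((int \<times> int) \<times> int \<times> cgen) fvec"
  where
    "pi_ver_gen \<theta> ((m, n), Tu) = scl (tq \<theta> powi n) (bas ((m + 1, n), (- 1, Ct)))"
  | "pi_ver_gen \<theta> ((m, n), Tv) = scl (- 1) (bas ((m, n + 1), (- 1, Ct)))"
  | "pi_ver_gen \<theta> _ = 0"

text \<open>Both terms of \<open>tor_form1\<close> land on the same basis vector, with factors p and
  -r, matching S(t^(p-r)) d(t^(p-r)) = (p - r) t^-1 dt.\<close>

lemma torus_pi_ver:
  assumes "\<omega> \<in> hcomp (tor_frm \<theta>) 1"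
  shows "pi_ver (torus \<theta>) \<omega> = linext (pi_ver_gen \<theta>) \<omega>"
proof -
  let ?F = "linext (pi_ver_gen \<theta>)" and ?G = "{bas i |i. deg (tor_frm \<theta>) i = 1}"
  let ?form = "\<lambda>a b. mul (tor_frm \<theta>) (tor_emb a) (dif (tor_frm \<theta>) (tor_emb b))"
  let ?rhs = "\<lambda>a b. linext (\<lambda>(i, j, k). tens (mul (tor_alg \<theta>) a (bas i)) (sdif (torus \<theta>) (bas j) (bas k)))
     (tmap id (comul circ) (tor_coact \<theta> b))"
  let ?P = "\<lambda>R. \<forall>a b. R (?form a b) = ?rhs a b"
  have P: "?F (?form a b) = ?rhs a b" for a b
  proof (rule bilin_eqI[of "\<lambda>a b. ?F (?form a b)" ?rhs])
    show "bilin (\<lambda>a b. ?F (?form a b))"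
      by (intro bilinI lin_comp[OF lin_linext] bilinD[OF bilin_tor_form1])
    show "bilin ?rhs"
    proof (rule bilinI)
      show "lin (\<lambda>b. ?rhs a b)" for a by (intro lin_comp[OF lin_linext] lin_comp[OF lin_tmap] lin_tor_coact)
      have "lin (\<lambda>a. case x of (i, j, k) \<Rightarrow> tens (mul (tor_alg \<theta>) a (bas i)) (sdif (torus \<theta>) (bas j) (bas k)))" for x
        by (cases x) (simp add: bilin_compL[OF bilin_tens bilinD(2)[OF bilin_tor_alg]])
      then show "lin (\<lambda>a. ?rhs a b)" for b by (rule lin_linext_param)
    qed
    show "?F (?form (bas i) (bas j)) = ?rhs (bas i) (bas j)" for i j
      by (cases i; cases j)
        (simp only: tor_form1 lin_add[OF lin_linext] lin_scl[OF lin_linext],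
         simp add: torus_sdif tens_simps scl_single tens_single power_int_add power_int_diff right_diff_distrib add.commute diff_diff_eq
           flip: single_add,
         simp add: field_simps)
  qed
  have "the_lin (fvec.span ?G) ?P = (\<lambda>x. if x \<in> fvec.span ?G then ?F x else 0)"
  proof (rule the_lin_eq[OF lin_linext])
    show "?P (\<lambda>x. if x \<in> fvec.span ?G then ?F x else 0)"
      using P tor_emb_hcomp(3) unfolding hcomp_span[symmetric] by simp
    show "h y = ?F y" if "?P h" "y \<in> ?G" for h y
      using that(2)
      by (cases rule: tor_degree1_cases) (use that(1) P in \<open>simp_all only: tor_degree1_gen[of _ _ \<theta>]\<close>)
  qed
  then show ?thesis using assms unfolding hcomp_span[symmetric] by (simp add: pi_ver_def)
qed

text \<open>The adjoint coaction is trivial: t^n is group-like, so S(h_1) h_4 becomes t^-n t^n =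
  1.\<close>

lemma torus_ad_coact:
  assumes "\<eta> \<in> coinv_forms1 (torus \<theta>)"
  shows "ad_coact (torus \<theta>) \<eta> = tens \<eta> (bas 0)"
proof -
  let ?mc = "mc_form (torus \<theta>)"
  let ?rhs = "\<lambda>h. linext (\<lambda>(i, j, k, l). tens (sdif (torus \<theta>) (bas j) (bas k)) (mul circ (antipode circ (bas i)) (bas l))) (comul4 circ h)"
  let ?P = "\<lambda>R. \<forall>h. R (?mc h) = ?rhs h"
  have l: "lin ?mc" unfolding mc_form_def[abs_def] torus_sel by (intro lin_comp[OF lin_linext] lin_circ)
  have mc: "?mc (bas n) = scl (of_int n) dt_over_t" for n
    by (simp add: mc_form_def torus_sdif dt_over_t_eq)
  have P: "tens (?mc h) (bas 0) = ?rhs h" for h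
  proof (rule lin_eqI[of "\<lambda>h. tens (?mc h) (bas 0)"])
    show "lin (\<lambda>h. tens (?mc h) (bas 0))" by (rule bilin_compL[OF bilin_tens l])
    show "lin ?rhs" unfolding comul4_def by (intro lin_comp[OF lin_linext] lin_comp[OF lin_tmap] lin_circ)
    show "tens (?mc (bas n)) (bas 0) = ?rhs (bas n)" for n
      by (simp add: mc dt_over_t_eq comul4_def torus_sdif)
  qed
  have "the_lin (fvec.span {dt_over_t}) ?P = (\<lambda>x. if x \<in> fvec.span {dt_over_t} then tens x (bas 0) else 0)"
  proof (rule the_lin_eq[OF bilinD(2)[OF bilin_tens]])
    have "?mc h \<in> fvec.span {dt_over_t}" for h
      by (rule lin_subspaceI[OF l fvec.subspace_span]) (simp add: mc fvec.span_base fvec.span_scale)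
    with P show "?P (\<lambda>x. if x \<in> fvec.span {dt_over_t} then tens x (bas 0) else 0)" by simp
    show "h y = tens y (bas 0)" if h: "?P h" and y: "y \<in> {dt_over_t}" for h y
    proof -
      \<comment> \<open>The form t^-1 dt is \<open>?mc\<close> at t, so the prescription there
        already determines \<open>h\<close>.\<close>
      have "h (?mc (bas 1)) = tens (?mc (bas 1)) (bas 0)" using h P by metis
      then show ?thesis using y by (simp add: mc)
    qed
  qed
  then show ?thesis using assms by (simp add: ad_coact_def coinv_forms1_eq)
qed

lemma du_over_u_eq: "du_over_u \<theta> = bas ((- 1, 0), Tu)"
  unfolding du_over_u_def by (simp add: tor_frm_sel tor_simps)

text \<open>Only the slice at \<open>l\<close> occurs, and for \<open>x = 0\<close> none does, so
  the left side is then 0; \<open>s 0 = 0\<close> makes the right side agree.\<close>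

lemma tmap_on_tens_bas:
  assumes "s 0 = 0"
  shows "tmap_on s (tens x (bas l)) = tens (s x) (bas l)"
proof (cases "x = 0")
  case True
  then show ?thesis by (simp add: tmap_on_def tens_simps assms)
next
  case False
  have "slice l (tens x (bas l)) = x"
    unfolding slice_def
    by (rule lin_eqI[of "\<lambda>x. linext (\<lambda>(i, k). if k = l then bas i else 0) (tens x (bas l))" "\<lambda>x. x"])
      (simp_all add: lin_comp[OF lin_linext bilinD(2)[OF bilin_tens]])
  moreover have "snd ` Poly_Mapping.keys (tens x (bas l)) = {l}"
  proof -
    have "Poly_Mapping.keys (tens x (bas l)) = (\<lambda>i. (i, l)) ` Poly_Mapping.keys x"
      by (auto simp: in_keys_iff lookup_tens_bas split: if_splits)
    with False show ?thesis by (simp add: image_image image_constant_conv)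
  qed
  ultimately show ?thesis by (simp add: tmap_on_def)
qed

lemma torus_connection_form:
  "connection_form (torus \<theta>) (the_lin (coinv_forms1 (torus \<theta>)) (\<lambda>s. s dt_over_t = du_over_u \<theta>))"
proof -
  define s where "s = the_lin (coinv_forms1 (torus \<theta>)) (\<lambda>s. s dt_over_t = du_over_u \<theta>)"
  \<comment> \<open>\<open>the_lin_eq\<close> asks for a map linear on all forms over H; the value 0
    on the other basis vectors is an arbitrary choice.\<close>
  let ?f = "linext (\<lambda>i. if i = (- 1, Ct) then du_over_u \<theta> else 0)"
  have s: "s = (\<lambda>x. if x \<in> coinv_forms1 (torus \<theta>) then ?f x else 0)"
    unfolding s_def coinv_forms1_eq
    by (rule the_lin_eq[OF lin_linext]) (simp_all add: dt_over_t_eq fvec.span_base)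
  note l = lin_linext[of "\<lambda>i. if i = (- 1, Ct) then du_over_u \<theta> else 0"]
  have s_scl: "s (scl c dt_over_t) = scl c (du_over_u \<theta>)" for c
    by (simp add: s coinv_forms1_eq fvec.span_base fvec.span_scale lin_scl[OF l], simp add: dt_over_t_eq)
  have s0: "s 0 = 0" by (simp add: s lin_zero[OF l])
  have h: "scl c (du_over_u \<theta>) \<in> hcomp (tor_frm \<theta>) 1" for c
    by (simp add: du_over_u_eq scl_single single_hcomp tor_frm_sel)
  show ?thesis
    unfolding connection_form_def s_def[symmetric] torus_sel
  proof (intro conjI ballI)
    show "lin_on (coinv_forms1 (torus \<theta>)) s"
      by (auto simp: lin_on_def s coinv_forms1_eq fvec.span_add fvec.span_scale lin_add[OF l] lin_scl[OF l])
    fix \<eta> assume \<eta>: "\<eta> \<in> coinv_forms1 (torus \<theta>)"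
    then obtain c where c: "\<eta> = scl c dt_over_t" by (auto simp: coinv_forms1_eq fvec.span_singleton)
    show "s \<eta> \<in> hcomp (tor_frm \<theta>) 1" unfolding c s_scl by (rule h)
    \<comment> \<open>Colinearity holds because u^-1 du has weight 0, in accordance with the trivial
      adjoint coaction.\<close>
    show "right_coact1 (torus \<theta>) (s \<eta>) = tmap_on s (ad_coact (torus \<theta>) \<eta>)"
      unfolding torus_ad_coact[OF \<eta>] tmap_on_tens_bas[of s, OF s0]
      unfolding c s_scl torus_right_coact1[OF h]
      by (simp add: lin_scl[OF lin_linext] du_over_u_eq tens_simps)
    show "pi_ver (torus \<theta>) (s \<eta>) = tens (unt (tor_alg \<theta>)) \<eta>"
      unfolding c s_scl torus_pi_ver[OF h]
      by (simp add: lin_scl[OF lin_linext] du_over_u_eq dt_over_t_eq tens_simps, simp add: tor_alg_def)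
  qed
qed

theorem theorem6p1:
  fixes \<theta> :: real
  shows "complete_calculus (torus \<theta>) \<and>
    \<comment> \<open>(i)\<close>
    is_dsum (base_forms (torus \<theta>)) (emb (torus \<theta>) ` coinv (torus \<theta>)) (base_forms1 (torus \<theta>)) \<and>
    base_forms (torus \<theta>) = pullback_calculus (torus \<theta>) (coinv (torus \<theta>)) \<and>
    base_forms1 (torus \<theta>) =
      fvec.span {mul (tor_frm \<theta>) (tor_emb b) (dif (tor_frm \<theta>) (tor_emb b')) |b b'.
        b \<in> coinv (torus \<theta>) \<and> b' \<in> coinv (torus \<theta>)} \<and>
    \<comment> \<open>(ii)\<close>
    is_dsum (coinv_forms (torus \<theta>)) (fvec.span {unt circ_frm}) (coinv_forms1 (torus \<theta>)) \<and>
    ver_forms (torus \<theta>) =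
      sub_tens UNIV {x + y |x y. x \<in> fvec.span {unt circ_frm} \<and> y \<in> coinv_forms1 (torus \<theta>)} \<and>
    coinv_forms1 (torus \<theta>) = fvec.span {dt_over_t} \<and>
    hor_forms (torus \<theta>) =
      fvec.span {mul (tor_frm \<theta>) (mul (tor_frm \<theta>) (tor_emb a) \<omega>) (tor_emb a') |a \<omega> a'.
        \<omega> \<in> base_forms (torus \<theta>)} \<and>
    \<comment> \<open>(iii)\<close>
    connection_form (torus \<theta>)
      (the_lin (coinv_forms1 (torus \<theta>)) (\<lambda>s. s dt_over_t = du_over_u \<theta>))"
  using tor_extends_coact[of \<theta>] base_forms_dsum[of \<theta>] base_forms_pullback[of \<theta>] base_forms1_span[of \<theta>] coinv_forms_dsum[of \<theta>]
    coinv_forms_eq[of \<theta>] coinv_forms1_eq[of \<theta>] hor_forms_span[of \<theta>] torus_connection_form[of \<theta>]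
  unfolding complete_calculus_def ver_forms_def by metis

end
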